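(* For every pair of set superpartitions $I,J$, the product of the corresponding monomial functions in $\mathbf{sNCSym}$ is $$m_Im_J=\sum_{K\in I\sqcup\!\sqcup J}m_K .$$
   Context: Combinatorial objects. $[n]=\{1,\dots,n\}$, $[n]_0=[n]\cup\{0\}$, and $A^+=A\setminus\{0\}$. For $0\le m\le n+1$, a partial set supercomposition of bidegree $(n,m)$ (degree $n$, fermionic degree $m$) is a tuple $K=(K_1,\dots,K_q)$ of nonempty subsets of $[n]_0$ (blocks) such that $K_1^+\cup\dots\cup K_q^+=[n]$, $K_i\cap K_j\subseteq\{0\}$ for $i\ne j$, $0\in K_i$ exactly for $i\le m$ (these are the fermionic blocks), and the nonfermionic blocks $K_{m+1},\dots,K_q$ are ordered by increasing minimum. It is nontrivial if at most one of its blocks equals $\{0\}$. A set superpartition is a partial set supercomposition $I=(I_1,\dots,I_k)$ with $I_i\ne I_j$ and $\min(I_i\setminus I_j)<\min(I_j\setminus I_i)$ for all $i<j$, where $\min(\emptyset):=0$. For a set $A$ of nonnegative integers, $A[r]$ is obtained by adding $r$ to each nonzero element of $A$. For $K,L$ of bidegrees $(n,m)$ and $(p,q)$, $K/L$ is the tuple whose fermionic blocks are those of $K$ in order followed by those of $L[n]$ (each block of $L$ shifted by $n$) in order, and whose nonfermionic blocks are those of $K$ followed by those of $L[n]$. For set superpartitions $I$ (of degree $n$) and $J$, $I\sqcup\!\sqcup J$ is the set of all nontrivial partial set supercompositions obtained from $I/J$ by choosing a (possibly empty) collection of pairwise disjoint pairs $(I_i,J_j[n])$, consisting of a block $I_i$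 of $I$ and a block $J_j[n]$ of $J[n]$ that are not both fermionic, and replacing each chosen pair by its union $I_i\cup J_j[n]$; the order of the fermionic blocks is that inherited from $I/J$ (a union of a fermionic block with a nonfermionic block takes the position of the fermionic block), and nonfermionic blocks are sorted by minimum. Functions. Let $\mathcal A$ be the $\mathbb Q$-algebra of formal power series of bounded degree in variables $x_1,x_2,\dots$ and $\theta_1,\theta_2,\dots$ subject only to $x_i\theta_j=\theta_jx_i$ and $\theta_i\theta_j=-\theta_j\theta_i$ for all $i,j$ (so $\theta_i^2=0$ and the $x_i$ do not commute with each other). $\mathbf{sNCSym}\subset\mathcal A$ is the subalgebra of elements invariant under all finite permutations acting simultaneously on indices of $x$ and $\theta$. For $K$ of bidegree $(n,m)$, the monomial function $m_K\in\mathbf{sNCSym}$ is the sum of all words $\theta_{a_1}\cdots\theta_{a_m}x_{b_1}\cdots x_{b_n}$ with positive integer indices such that: for $i\in[m]$, $a_i=b_j$ if and only if $j\in K_i^+$; and for $i,j\in[n]$, $b_i=b_j$ if and only if $i,j$ lie in the same block of $K$. *)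

theory Defs
  imports Complex_Main
begin

section \<open>The algebra \<open>\<A>\<close>\<close>

text \<open>
  Since the \<open>\<theta>\<close>s anticommute and commute with the \<open>x\<close>s, every monomial is, up to sign, of the
  form \<open>\<theta>\<^bsub>t\<^sub>1\<^esub> \<cdots> \<theta>\<^bsub>t\<^sub>r\<^esub> x\<^bsub>b\<^sub>1\<^esub> \<cdots> x\<^bsub>b\<^sub>s\<^esub>\<close> with \<open>t\<^sub>1 < \<dots> < t\<^sub>r\<close>. A series is its family of
  coefficients, indexed by the finite set \<open>T = {t\<^sub>1,\<dots>,t\<^sub>r}\<close> and the word \<open>w = [b\<^sub>1,\<dots>,b\<^sub>s]\<close> of
  positive integers.
\<close>

typedef superseries =
  "{f :: nat set \<Rightarrow> nat list \<Rightarrow> rat.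
      (\<forall>T w. f T w \<noteq> 0 \<longrightarrow> finite T \<and> 0 \<notin> T \<and> 0 \<notin> set w) \<and>
      (\<exists>d. \<forall>T w. f T w \<noteq> 0 \<longrightarrow> card T + length w \<le> d)}"
  morphisms coeff Abs_superseries
  by (rule exI[of _ "\<lambda>_ _. 0"]) auto

setup_lifting type_definition_superseries

text \<open>
  The increasing products satisfy \<open>\<theta>\<^sub>S \<theta>\<^sub>T = (-1)\<^bsup>inversions S T\<^esup> \<theta>\<^bsub>S \<union> T\<^esub>\<close> for disjoint \<open>S\<close>, \<open>T\<close>
  and \<open>\<theta>\<^sub>S \<theta>\<^sub>T = 0\<close> otherwise; \<open>conv\<close> is the resulting Cauchy product.
\<close>

definition inversions :: "nat set \<Rightarrow> nat set \<Rightarrow> nat" where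
  "inversions S T = card {(s, t). s \<in> S \<and> t \<in> T \<and> t < s}"

definition conv ::
  "(nat set \<Rightarrow> nat list \<Rightarrow> rat) \<Rightarrow> (nat set \<Rightarrow> nat list \<Rightarrow> rat) \<Rightarrow> nat set \<Rightarrow> nat list \<Rightarrow> rat" where
  "conv f g U w =
     (\<Sum>T\<in>Pow U. \<Sum>k\<le>length w.
        (-1) ^ inversions T (U - T) * f T (take k w) * g (U - T) (drop k w))"

lemma conv_nonzero:
  assumes "conv f g U w \<noteq> 0"
  obtains T k where "finite U" "T \<subseteq> U" "k \<le> length w" "f T (take k w) \<noteq> 0" "g (U - T) (drop k w) \<noteq> 0"
proof -
  have "finite (Pow U)"
    using assms unfolding conv_def by (meson sum.infinite)
  moreover obtain T where T: "T \<in> Pow U"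
    "(\<Sum>k\<le>length w. (-1) ^ inversions T (U - T) * f T (take k w) * g (U - T) (drop k w)) \<noteq> 0"
    using assms unfolding conv_def by (meson sum.neutral)
  moreover obtain k where "k \<in> {..length w}"
    "(-1) ^ inversions T (U - T) * f T (take k w) * g (U - T) (drop k w) \<noteq> 0"
    using T(2) by (meson sum.neutral)
  ultimately show ?thesis
    using that[of T k] by auto
qed

lemma inversions_Un_left:
  assumes "finite S" "finite S'" "finite T" "S \<inter> S' = {}"
  shows "inversions (S \<union> S') T = inversions S T + inversions S' T"
proof -
  have "{(s, t). s \<in> S \<union> S' \<and> t \<in> T \<and> t < s} =
        {(s, t). s \<in> S \<and> t \<in> T \<and> t < s} \<union> {(s, t). s \<in> S' \<and> t \<in> T \<and> t < s}" by auto
  moreover have "finite {(s, t). s \<in> S \<and> t \<in> T \<and> t < s}"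
    by (rule finite_subset[of _ "S \<times> T"]) (use assms in auto)
  moreover have "finite {(s, t). s \<in> S' \<and> t \<in> T \<and> t < s}"
    by (rule finite_subset[of _ "S' \<times> T"]) (use assms in auto)
  moreover have "{(s, t). s \<in> S \<and> t \<in> T \<and> t < s} \<inter> {(s, t). s \<in> S' \<and> t \<in> T \<and> t < s} = {}"
    using assms by auto
  ultimately show ?thesis
    unfolding inversions_def by (simp add: card_Un_disjoint)
qed

lemma inversions_Un_right:
  assumes "finite S" "finite T" "finite T'" "T \<inter> T' = {}"
  shows "inversions S (T \<union> T') = inversions S T + inversions S T'"
proof -
  have "{(s, t). s \<in> S \<and> t \<in> T \<union> T' \<and> t < s} =
        {(s, t). s \<in> S \<and> t \<in> T \<and> t < s} \<union> {(s, t). s \<in> S \<and> t \<in> T' \<and> t < s}" by auto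
  moreover have "finite {(s, t). s \<in> S \<and> t \<in> T \<and> t < s}"
    by (rule finite_subset[of _ "S \<times> T"]) (use assms in auto)
  moreover have "finite {(s, t). s \<in> S \<and> t \<in> T' \<and> t < s}"
    by (rule finite_subset[of _ "S \<times> T'"]) (use assms in auto)
  moreover have "{(s, t). s \<in> S \<and> t \<in> T \<and> t < s} \<inter> {(s, t). s \<in> S \<and> t \<in> T' \<and> t < s} = {}"
    using assms by auto
  ultimately show ?thesis
    unfolding inversions_def by (simp add: card_Un_disjoint)
qed

lemma inversions_empty [simp]: "inversions {} T = 0" "inversions S {} = 0"
  by (auto simp: inversions_def)

lemma sum_sum_Sigma:
  assumes "finite A" "finite B" "\<And>a. a \<in> A \<Longrightarrow> finite (C a)" "\<And>b. b \<in> B \<Longrightarrow> finite (D b)"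
  shows "(\<Sum>a\<in>A. \<Sum>b\<in>B. \<Sum>c\<in>C a. \<Sum>d\<in>D b. F a b c d) =
    (\<Sum>((a, b), c, d) \<in> Sigma (A \<times> B) (\<lambda>(a, b). C a \<times> D b). F a b c d)"
proof -
  have "(\<Sum>a\<in>A. \<Sum>b\<in>B. \<Sum>c\<in>C a. \<Sum>d\<in>D b. F a b c d) =
      (\<Sum>p\<in>A \<times> B. \<Sum>q\<in>(case p of (a, b) \<Rightarrow> C a \<times> D b). case (p, q) of ((a, b), c, d) \<Rightarrow> F a b c d)"
    by (simp add: sum.cartesian_product split_def)
  also have "\<dots> = (\<Sum>((a, b), c, d) \<in> Sigma (A \<times> B) (\<lambda>(a, b). C a \<times> D b). F a b c d)"
    by (subst sum.Sigma) (use assms in \<open>auto intro!: sum.cong\<close>)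
  finally show ?thesis .
qed

lemma conv_assoc:
  assumes U: "finite U"
  shows "conv (conv f g) h U w = conv f (conv g h) U w"
proof -
  let ?s = "\<lambda>S T. (-1 :: rat) ^ inversions S T"
  have fin: "finite T" if "T \<subseteq> U" for T using that U finite_subset by blast
  have "conv (conv f g) h U w =
     (\<Sum>T\<in>Pow U. \<Sum>k\<le>length w. \<Sum>S\<in>Pow T. \<Sum>l\<le>k.
        ?s T (U - T) * ?s S (T - S) * f S (take l (take k w)) * g (T - S) (drop l (take k w))
          * h (U - T) (drop k w))"
    unfolding conv_def
    by (intro sum.cong refl) (simp add: sum_distrib_left sum_distrib_right mult_ac min_absorb2)
  also have "\<dots> = (\<Sum>((T, k), S, l) \<in> Sigma (Pow U \<times> {..length w}) (\<lambda>(T, k). Pow T \<times> {..k}).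
        ?s T (U - T) * ?s S (T - S) * f S (take l (take k w)) * g (T - S) (drop l (take k w))
          * h (U - T) (drop k w))"
    by (rule sum_sum_Sigma) (use U fin in auto)
  also have "\<dots> = (\<Sum>((S, l), R, m) \<in> Sigma (Pow U \<times> {..length w}) (\<lambda>(S, l). Pow (U - S) \<times> {..length w - l}).
        ?s S (U - S) * ?s R (U - S - R) * f S (take l w) * g R (take m (drop l w))
          * h (U - S - R) (drop m (drop l w)))"
  proof (rule sum.reindex_bij_witness
      [where i = "\<lambda>((S, l), R, m). ((S \<union> R, l + m), S, l)"
         and j = "\<lambda>((T, k), S, l). ((S, l), T - S, k - l)"], goal_cases)
    case (1 a) then show ?case by auto
  next
    case (2 a) then show ?case by auto
  next
    case (3 b) then show ?case by auto
  next
    case (4 b) then show ?case by auto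
  next
    case (5 a)
    obtain T k S l where a: "a = ((T, k), S, l)" by (metis surj_pair)
    have sub: "T \<subseteq> U" "S \<subseteq> T" "k \<le> length w" "l \<le> k" using 5 a by auto
    have e1: "U - S - (T - S) = U - T" using sub by auto
    have e2: "U - S = (T - S) \<union> (U - T)" using sub by auto
    have e3: "T = S \<union> (T - S)" using sub by auto
    have "inversions T (U - T) = inversions (S \<union> (T - S)) (U - T)" using e3 by simp
    also have "\<dots> = inversions S (U - T) + inversions (T - S) (U - T)"
      by (rule inversions_Un_left) (use sub fin U in \<open>auto dest: finite_subset\<close>)
    finally have i1: "inversions T (U - T) = inversions S (U - T) + inversions (T - S) (U - T)" .
    have i2: "inversions S (U - S) = inversions S (T - S) + inversions S (U - T)"
      unfolding e2 by (rule inversions_Un_right) (use sub fin U in \<open>auto dest: finite_subset\<close>)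
    have t1: "take l (take k w) = take l w" using sub by (simp add: min_absorb1)
    have t2: "take (k - l) (drop l w) = drop l (take k w)" by (simp add: drop_take)
    have t3: "drop (k - l) (drop l w) = drop k w" using sub by simp
    show ?case
      unfolding a prod.case e1 t1 t2 t3 i1 i2 by (simp add: power_add mult_ac)
  qed
  also have "\<dots> = (\<Sum>S\<in>Pow U. \<Sum>l\<le>length w. \<Sum>R\<in>Pow (U - S). \<Sum>m\<le>length w - l.
        ?s S (U - S) * ?s R (U - S - R) * f S (take l w) * g R (take m (drop l w))
          * h (U - S - R) (drop m (drop l w)))"
    by (rule sum_sum_Sigma[symmetric]) (use U in auto)
  also have "\<dots> = conv f (conv g h) U w"
    unfolding conv_def
    by (intro sum.cong refl) (simp add: sum_distrib_left sum_distrib_right mult_ac)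
  finally show ?thesis .
qed

lemma conv_one_left:
  assumes "finite U"
  shows "conv (\<lambda>T w. if T = {} \<and> w = [] then 1 else 0) f U w = f U w"
proof -
  have "conv (\<lambda>T w. if T = {} \<and> w = [] then 1 else 0) f U w =
     (\<Sum>T\<in>Pow U. \<Sum>k\<le>length w. if T = {} then if k = 0 then f U w else 0 else 0)"
    unfolding conv_def by (intro sum.cong refl) auto
  also have "\<dots> = (\<Sum>T\<in>Pow U. if T = {} then f U w else 0)"
    by (intro sum.cong refl) simp
  also have "\<dots> = f U w" using assms by simp
  finally show ?thesis .
qed

lemma conv_one_right:
  assumes "finite U"
  shows "conv f (\<lambda>T w. if T = {} \<and> w = [] then 1 else 0) U w = f U w"
proof -
  have "conv f (\<lambda>T w. if T = {} \<and> w = [] then 1 else 0) U w =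
     (\<Sum>T\<in>Pow U. \<Sum>k\<le>length w. if T = U then if k = length w then f U w else 0 else 0)"
    unfolding conv_def by (intro sum.cong refl) auto
  also have "\<dots> = (\<Sum>T\<in>Pow U. if T = U then f U w else 0)"
    by (intro sum.cong refl) simp
  also have "\<dots> = f U w" using assms by simp
  finally show ?thesis .
qed

lemma coeff_infinite: "infinite T \<Longrightarrow> coeff f T w = 0"
  using coeff[of f] by auto

lemma superseries_eqI: "(\<And>T w. finite T \<Longrightarrow> coeff f T w = coeff g T w) \<Longrightarrow> f = g"
  by (metis coeff_inject coeff_infinite ext)

instantiation superseries :: ring_1
begin

lift_definition zero_superseries :: superseries is "\<lambda>_ _. 0" by auto

lift_definition one_superseries :: superseries is "\<lambda>T w. if T = {} \<and> w = [] then 1 else 0"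
  by (auto split: if_splits)

lift_definition plus_superseries :: "superseries \<Rightarrow> superseries \<Rightarrow> superseries"
  is "\<lambda>f g T w. f T w + g T w"
proof -
  fix f g :: "nat set \<Rightarrow> nat list \<Rightarrow> rat"
  assume f: "(\<forall>T w. f T w \<noteq> 0 \<longrightarrow> finite T \<and> 0 \<notin> T \<and> 0 \<notin> set w) \<and>
      (\<exists>d. \<forall>T w. f T w \<noteq> 0 \<longrightarrow> card T + length w \<le> d)"
  assume g: "(\<forall>T w. g T w \<noteq> 0 \<longrightarrow> finite T \<and> 0 \<notin> T \<and> 0 \<notin> set w) \<and>
      (\<exists>d. \<forall>T w. g T w \<noteq> 0 \<longrightarrow> card T + length w \<le> d)"
  obtain d e where "\<And>T w. f T w \<noteq> 0 \<Longrightarrow> card T + length w \<le> d" "\<And>T w. g T w \<noteq> 0 \<Longrightarrow> card T + length w \<le> e"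
    using f g by blast
  then have "card T + length w \<le> max d e" if "f T w + g T w \<noteq> 0" for T w
    using that by (metis add.right_neutral le_max_iff_disj add_0)
  moreover have "finite T \<and> 0 \<notin> T \<and> 0 \<notin> set w" if "f T w + g T w \<noteq> 0" for T w
    using that f g by (metis add.right_neutral)
  ultimately show "(\<forall>T w. f T w + g T w \<noteq> 0 \<longrightarrow> finite T \<and> 0 \<notin> T \<and> 0 \<notin> set w) \<and>
      (\<exists>d. \<forall>T w. f T w + g T w \<noteq> 0 \<longrightarrow> card T + length w \<le> d)"
    by blast
qed

lift_definition uminus_superseries :: "superseries \<Rightarrow> superseries" is "\<lambda>f T w. - f T w" by auto

definition minus_superseries :: "superseries \<Rightarrow> superseries \<Rightarrow> superseries" where
  "minus_superseries f g = f + - g"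

lift_definition times_superseries :: "superseries \<Rightarrow> superseries \<Rightarrow> superseries" is conv
proof -
  fix f g :: "nat set \<Rightarrow> nat list \<Rightarrow> rat"
  assume f: "(\<forall>T w. f T w \<noteq> 0 \<longrightarrow> finite T \<and> 0 \<notin> T \<and> 0 \<notin> set w) \<and>
      (\<exists>d. \<forall>T w. f T w \<noteq> 0 \<longrightarrow> card T + length w \<le> d)"
  assume g: "(\<forall>T w. g T w \<noteq> 0 \<longrightarrow> finite T \<and> 0 \<notin> T \<and> 0 \<notin> set w) \<and>
      (\<exists>d. \<forall>T w. g T w \<noteq> 0 \<longrightarrow> card T + length w \<le> d)"
  obtain d e where d: "\<And>T w. f T w \<noteq> 0 \<Longrightarrow> card T + length w \<le> d"
    and e: "\<And>T w. g T w \<noteq> 0 \<Longrightarrow> card T + length w \<le> e"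
    using f g by blast
  have "finite U \<and> 0 \<notin> U \<and> 0 \<notin> set w \<and> card U + length w \<le> d + e" if nz: "conv f g U w \<noteq> 0" for U w
  proof -
    obtain T k where Tk: "finite U" "T \<subseteq> U" "k \<le> length w" "f T (take k w) \<noteq> 0" "g (U - T) (drop k w) \<noteq> 0"
      using conv_nonzero[OF nz] .
    have "0 \<notin> U" using Tk f g by (metis DiffI)
    moreover have "0 \<notin> set w"
      using Tk f g by (metis Un_iff append_take_drop_id set_append)
    moreover have "card U = card T + card (U - T)"
      using Tk by (metis card_Diff_subset card_mono finite_subset le_add_diff_inverse)
    ultimately show ?thesis
      using d[OF Tk(4)] e[OF Tk(5)] Tk by simp
  qed
  then show "(\<forall>T w. conv f g T w \<noteq> 0 \<longrightarrow> finite T \<and> 0 \<notin> T \<and> 0 \<notin> set w) \<and>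
      (\<exists>d. \<forall>T w. conv f g T w \<noteq> 0 \<longrightarrow> card T + length w \<le> d)"
    by blast
qed

instance
proof
  fix a b c :: superseries
  show "a + b + c = a + (b + c)" by transfer (simp add: add.assoc)
  show "a + b = b + a" by transfer (simp add: add.commute)
  show "0 + a = a" by transfer simp
  show "- a + a = 0" by transfer simp
  show "a - b = a + - b" by (fact minus_superseries_def)
  show "a * b * c = a * (b * c)"
    by (rule superseries_eqI) (simp add: times_superseries.rep_eq conv_assoc)
  show "1 * a = a"
    by (rule superseries_eqI) (simp add: times_superseries.rep_eq one_superseries.rep_eq conv_one_left)
  show "a * 1 = a"
    by (rule superseries_eqI) (simp add: times_superseries.rep_eq one_superseries.rep_eq conv_one_right)
  show "(a + b) * c = a * c + b * c"
    by (rule superseries_eqI)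
       (simp add: times_superseries.rep_eq plus_superseries.rep_eq conv_def algebra_simps sum.distrib)
  show "a * (b + c) = a * b + a * c"
    by (rule superseries_eqI)
       (simp add: times_superseries.rep_eq plus_superseries.rep_eq conv_def algebra_simps sum.distrib)
  have "coeff 0 {} [] \<noteq> coeff 1 {} []" by transfer simp
  then show "(0 :: superseries) \<noteq> 1" by metis
qed

end

text \<open>The variables are indexed by the positive integers; index \<open>0\<close> gives the junk value \<open>0\<close>.\<close>

lift_definition var_x :: "nat \<Rightarrow> superseries" is
  "\<lambda>i T w. if 0 < i \<and> T = {} \<and> w = [i] then 1 else 0"
  by (auto split: if_splits intro!: exI[of _ 1])

lift_definition var_theta :: "nat \<Rightarrow> superseries" is
  "\<lambda>i T w. if 0 < i \<and> T = {i} \<and> w = [] then 1 else 0"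
  by (auto split: if_splits intro!: exI[of _ 1])

definition theta_x_word :: "nat list \<Rightarrow> nat list \<Rightarrow> superseries" where
  "theta_x_word a b = prod_list (map var_theta a) * prod_list (map var_x b)"

fun theta_sign :: "nat list \<Rightarrow> rat" where
  "theta_sign [] = 1"
| "theta_sign (i # a) = (-1) ^ inversions {i} (set a) * theta_sign a"

lemma coeff_var_theta_times:
  "coeff (var_theta i * f) U w =
     (if 0 < i \<and> i \<in> U then (-1) ^ inversions {i} (U - {i}) * coeff f (U - {i}) w else 0)"
proof (cases "finite U")
  case True
  have "coeff (var_theta i * f) U w = (\<Sum>T\<in>Pow U. \<Sum>k\<le>length w.
      if T = {i} then if k = 0 then if 0 < i then (-1) ^ inversions {i} (U - {i}) * coeff f (U - {i}) w
        else 0 else 0 else 0)"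
    unfolding times_superseries.rep_eq conv_def var_theta.rep_eq
    by (intro sum.cong refl) auto
  also have "\<dots> = (\<Sum>T\<in>Pow U. if T = {i} then if 0 < i then
      (-1) ^ inversions {i} (U - {i}) * coeff f (U - {i}) w else 0 else 0)"
    by (intro sum.cong refl) simp
  also have "\<dots> = (if 0 < i \<and> i \<in> U then (-1) ^ inversions {i} (U - {i}) * coeff f (U - {i}) w else 0)"
    using True by simp
  finally show ?thesis .
qed (simp add: coeff_infinite)

lemma coeff_times_var_x:
  "coeff (f * var_x i) U w = (if 0 < i \<and> w \<noteq> [] \<and> last w = i then coeff f U (butlast w) else 0)"
proof (cases "finite U")
  case True
  have "coeff (f * var_x i) U w = (\<Sum>T\<in>Pow U. \<Sum>k\<le>length w.
      if T = U then if k = length w - 1 then if 0 < i \<and> w \<noteq> [] \<and> last w = i then coeff f U (butlast w)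
        else 0 else 0 else 0)"
    unfolding times_superseries.rep_eq conv_def var_x.rep_eq
  proof (intro sum.cong refl, goal_cases)
    case (1 T k)
    have "drop k w = [i] \<longleftrightarrow> k = length w - 1 \<and> w \<noteq> [] \<and> last w = i"
      using 1(2) by (cases w rule: rev_cases) (auto simp: drop_Cons' append_eq_Cons_conv)
    moreover have "U - T = {} \<longleftrightarrow> T = U" using 1(1) by auto
    ultimately show ?case by (cases "T = U") (simp_all add: butlast_conv_take)
  qed
  also have "\<dots> = (\<Sum>T\<in>Pow U. if T = U then if 0 < i \<and> w \<noteq> [] \<and> last w = i
      then coeff f U (butlast w) else 0 else 0)"
    by (intro sum.cong refl) (simp add: sum.delta)
  also have "\<dots> = (if 0 < i \<and> w \<noteq> [] \<and> last w = i then coeff f U (butlast w) else 0)"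
    using True by simp
  finally show ?thesis .
qed (simp add: coeff_infinite)

lemma coeff_theta_word:
  "coeff (prod_list (map var_theta a)) U w =
     (if distinct a \<and> 0 \<notin> set a \<and> U = set a \<and> w = [] then theta_sign a else 0)"
proof (induction a arbitrary: U w)
  case Nil
  show ?case by (simp add: one_superseries.rep_eq)
next
  case (Cons i a)
  have "i \<in> U \<and> U - {i} = set a \<longleftrightarrow> i \<notin> set a \<and> U = insert i (set a)" by auto
  then show ?case
    by (cases "i \<in> U \<and> U - {i} = set a") (auto simp add: coeff_var_theta_times Cons.IH)
qed

lemma coeff_theta_x_word:
  "coeff (theta_x_word a b) U w =
     (if distinct a \<and> 0 \<notin> set a \<and> 0 \<notin> set b \<and> U = set a \<and> w = b then theta_sign a else 0)"
proof (induction b arbitrary: w rule: rev_induct)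
  case Nil
  show ?case by (simp add: theta_x_word_def coeff_theta_word)
next
  case (snoc i b)
  have "theta_x_word a (b @ [i]) = theta_x_word a b * var_x i"
    by (simp add: theta_x_word_def mult.assoc)
  then show ?case
    using snoc[of "butlast w"] by (cases w rule: rev_cases) (auto simp: coeff_times_var_x)
qed

lemma var_theta_anticommute: "var_theta i * var_theta j = - (var_theta j * var_theta i)"
proof (rule superseries_eqI)
  fix T w
  have inv: "inversions {k} {l} = (if l < k then 1 else 0)" for k l
  proof -
    have "{(s, t). s \<in> {k} \<and> t \<in> {l} \<and> t < s} = (if l < k then {(k, l)} else {})" by auto
    then show ?thesis by (simp add: inversions_def)
  qed
  have word: "coeff (var_theta k * var_theta l) T w =
      (if k \<noteq> l \<and> k \<noteq> 0 \<and> l \<noteq> 0 \<and> T = {k, l} \<and> w = [] then if l < k then -1 else 1 else 0)" for k l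
    using coeff_theta_word[of "[k, l]" T w] by (simp add: inv)
  show "coeff (var_theta i * var_theta j) T w = coeff (- (var_theta j * var_theta i)) T w"
    unfolding uminus_superseries.rep_eq word
    by (cases i j rule: linorder_cases) (simp_all add: insert_commute)
qed

lemma var_x_theta_commute: "var_x i * var_theta j = var_theta j * var_x i"
proof (rule superseries_eqI)
  fix U :: "nat set" and w
  assume U: "finite U"
  have "coeff (var_x i * var_theta j) U w = (\<Sum>T\<in>Pow U. \<Sum>k\<le>length w.
      if T = {} then if k = 1 then if 0 < i \<and> 0 < j \<and> U = {j} \<and> w = [i] then 1 else 0 else 0 else 0)"
    unfolding times_superseries.rep_eq conv_def var_x.rep_eq var_theta.rep_eq
  proof (intro sum.cong refl, goal_cases)
    case (1 T k)
    have "take k w = [i] \<and> drop k w = [] \<longleftrightarrow> k = 1 \<and> w = [i]"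
    proof
      assume a: "take k w = [i] \<and> drop k w = []"
      then have "w = [i]" by (metis append_take_drop_id append_Nil2)
      moreover have "k = 1" using a 1(2) \<open>w = [i]\<close> by (cases k) auto
      ultimately show "k = 1 \<and> w = [i]" by simp
    qed auto
    then show ?case by auto
  qed
  also have "\<dots> = (\<Sum>T\<in>Pow U. if T = {} then if 0 < i \<and> 0 < j \<and> U = {j} \<and> w = [i] then 1 else 0 else 0)"
    by (intro sum.cong refl) auto
  also have "\<dots> = (if 0 < i \<and> 0 < j \<and> U = {j} \<and> w = [i] then 1 else 0)"
    using U by simp
  also have "\<dots> = coeff (var_theta j * var_x i) U w"
    by (auto simp: coeff_var_theta_times var_x.rep_eq)
  finally show "coeff (var_x i * var_theta j) U w = coeff (var_theta j * var_x i) U w" .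
qed

text \<open>
  Invariance under the simultaneous permutations of the indices: applying \<open>\<sigma>\<close> to the term
  \<open>coeff f T v \<cdot> \<theta>\<^sub>T x\<^sub>v\<close> of \<open>f\<close> must give the term of \<open>f\<close> at \<open>(\<sigma> T, \<sigma> v)\<close>; the last factor is the sign
  that arises from sorting the image of \<open>\<theta>\<^sub>T\<close>.
\<close>

definition sNCSym :: "superseries set" where
  "sNCSym = {f. \<forall>\<sigma> N T v. bij_betw \<sigma> {1..N} {1..N} \<longrightarrow> T \<subseteq> {1..N} \<longrightarrow> set v \<subseteq> {1..N} \<longrightarrow>
     coeff f (\<sigma> ` T) (map \<sigma> v) =
       coeff f T v *
       coeff (theta_x_word (map \<sigma> (sorted_list_of_set T)) (map \<sigma> v)) (\<sigma> ` T) (map \<sigma> v)}"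


section \<open>Partial set supercompositions and set superpartitions\<close>

definition partial_set_supercomposition :: "nat \<Rightarrow> nat \<Rightarrow> nat set list \<Rightarrow> bool" where
  "partial_set_supercomposition n m K \<longleftrightarrow>
     m \<le> n + 1 \<and> m \<le> length K \<and>
     (\<forall>A\<in>set K. A \<noteq> {} \<and> A \<subseteq> {0..n}) \<and>
     (\<Union>A\<in>set K. A - {0}) = {1..n} \<and>
     (\<forall>i<length K. \<forall>j<length K. i \<noteq> j \<longrightarrow> K ! i \<inter> K ! j \<subseteq> {0}) \<and>
     (\<forall>i<length K. 0 \<in> K ! i \<longleftrightarrow> i < m) \<and>
     (\<forall>i j. m \<le> i \<longrightarrow> i < j \<longrightarrow> j < length K \<longrightarrow> Min (K ! i) < Min (K ! j))"

definition nontrivial :: "nat set list \<Rightarrow> bool" where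
  "nontrivial K \<longleftrightarrow> length (filter (\<lambda>A. A = {0}) K) \<le> 1"

definition min0 :: "nat set \<Rightarrow> nat" where
  "min0 A = (if A = {} then 0 else Min A)"

definition set_superpartition :: "nat \<Rightarrow> nat \<Rightarrow> nat set list \<Rightarrow> bool" where
  "set_superpartition n m I \<longleftrightarrow>
     partial_set_supercomposition n m I \<and>
     (\<forall>i j. i < j \<longrightarrow> j < length I \<longrightarrow>
        I ! i \<noteq> I ! j \<and> min0 (I ! i - I ! j) < min0 (I ! j - I ! i))"

text \<open>The bidegree \<open>(n, m)\<close> is determined by the blocks.\<close>

definition degr :: "nat set list \<Rightarrow> nat" where
  "degr K = card (\<Union>A\<in>set K. A - {0})"

definition fdegr :: "nat set list \<Rightarrow> nat" where
  "fdegr K = length (filter (\<lambda>A. 0 \<in> A) K)"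

lemma fermionic_prefix:
  assumes "partial_set_supercomposition n m K"
  shows "filter (\<lambda>A. 0 \<in> A) K = take m K" "filter (\<lambda>A. 0 \<notin> A) K = drop m K"
proof -
  have m: "m \<le> length K" and *: "\<And>i. i < length K \<Longrightarrow> 0 \<in> K ! i \<longleftrightarrow> i < m"
    using assms by (auto simp: partial_set_supercomposition_def)
  have a: "\<forall>A\<in>set (take m K). 0 \<in> A" and b: "\<forall>A\<in>set (drop m K). 0 \<notin> A"
    using m * by (auto simp: in_set_conv_nth)
  have "filter (\<lambda>A. 0 \<in> A) (take m K @ drop m K) = take m K"
    "filter (\<lambda>A. 0 \<notin> A) (take m K @ drop m K) = drop m K"
    unfolding filter_append using a b by simp_all
  then show "filter (\<lambda>A. 0 \<in> A) K = take m K" "filter (\<lambda>A. 0 \<notin> A) K = drop m K"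
    by simp_all
qed

lemma partial_set_supercomposition_bidegree:
  assumes "partial_set_supercomposition n m K"
  shows "degr K = n" "fdegr K = m"
proof -
  have "(\<Union>A\<in>set K. A - {0}) = {1..n}" "m \<le> length K"
    using assms unfolding partial_set_supercomposition_def by blast+
  then show "degr K = n" "fdegr K = m"
    by (simp_all only: degr_def fdegr_def fermionic_prefix(1)[OF assms] length_take) simp_all
qed

definition shift :: "nat \<Rightarrow> nat set \<Rightarrow> nat set" where
  "shift r A = (\<lambda>a. if a = 0 then 0 else a + r) ` A"

definition slash :: "nat set list \<Rightarrow> nat set list \<Rightarrow> nat set list" where
  "slash K L =
     (let L' = map (shift (degr K)) L in
      filter (\<lambda>A. 0 \<in> A) K @ filter (\<lambda>A. 0 \<in> A) L' @
      filter (\<lambda>A. 0 \<notin> A) K @ filter (\<lambda>A. 0 \<notin> A) L')"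

text \<open>
  Blocks are paired by position (counted from 0), not by value: a block \<open>{0}\<close> of \<open>I\<close> equals its
  counterpart in \<open>J\<close>.
\<close>

definition block_pairing :: "nat set list \<Rightarrow> nat set list \<Rightarrow> (nat \<times> nat) set \<Rightarrow> bool" where
  "block_pairing I J M \<longleftrightarrow>
     M \<subseteq> {..<length I} \<times> {..<length J} \<and> inj_on fst M \<and> inj_on snd M \<and>
     (\<forall>(i, j)\<in>M. \<not> (0 \<in> I ! i \<and> 0 \<in> J ! j))"

text \<open>
  \<open>left i\<close> and \<open>right j\<close> are the blocks that contain \<open>I\<^sub>i\<close> and \<open>J\<^sub>j[n]\<close> after the replacement. A union
  is listed in place of its fermionic constituent if it has one, and otherwise (once, as \<open>left i\<close>)
  among the nonfermionic blocks.
\<close>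

definition merge :: "nat set list \<Rightarrow> nat set list \<Rightarrow> (nat \<times> nat) set \<Rightarrow> nat set list" where
  "merge I J M =
     (let J' = map (shift (degr I)) J;
          left = (\<lambda>i. I ! i \<union> \<Union>{J' ! j | j. (i, j) \<in> M});
          right = (\<lambda>j. J' ! j \<union> \<Union>{I ! i | i. (i, j) \<in> M})
      in map left (filter (\<lambda>i. 0 \<in> I ! i) [0..<length I]) @
         map right (filter (\<lambda>j. 0 \<in> J' ! j) [0..<length J]) @
         sort_key Min
           (map left (filter (\<lambda>i. 0 \<notin> left i) [0..<length I]) @
            map right (filter (\<lambda>j. 0 \<notin> J' ! j \<and> j \<notin> snd ` M) [0..<length J])))"

lemma merge_empty:
  assumes I: "partial_set_supercomposition n m I" and J: "partial_set_supercomposition p q J"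
  shows "merge I J {} = slash I J"
proof -
  let ?J' = "map (shift (degr I)) J"
  have sh: "0 \<in> shift r A \<longleftrightarrow> 0 \<in> A" for r A
    by (auto simp: shift_def image_iff)
  have filt: "map ((!) xs) (filter (\<lambda>i. P (xs ! i)) [0..<length xs]) = filter P xs" for P and xs :: "nat set list"
    using filter_map[of P "(!) xs" "[0..<length xs]"] by (simp add: map_nth comp_def)
  have sorted: "sorted (map Min (filter (\<lambda>A. 0 \<notin> A) I @ filter (\<lambda>A. 0 \<notin> A) ?J'))"
  proof -
    have blocks: "finite A \<and> A \<noteq> {} \<and> A \<subseteq> {0..n}" if "partial_set_supercomposition n m K" "A \<in> set K" for n m A K
    proof -
      have "\<forall>A\<in>set K. A \<noteq> {} \<and> A \<subseteq> {0..n}"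
        using that(1) unfolding partial_set_supercomposition_def by (elim conjE)
      then have "A \<noteq> {}" "A \<subseteq> {0..n}" using that(2) by simp_all
      then show ?thesis using finite_subset[of A "{0..n}"] by simp
    qed
    have sK: "sorted (map Min (filter (\<lambda>A. 0 \<notin> A) K))" if K: "partial_set_supercomposition n m K" for n m K
    proof -
      have "\<forall>i j. m \<le> i \<longrightarrow> i < j \<longrightarrow> j < length K \<longrightarrow> Min (K ! i) < Min (K ! j)"
        using K unfolding partial_set_supercomposition_def by (elim conjE)
      then show ?thesis
        unfolding fermionic_prefix(2)[OF K] sorted_iff_nth_mono_less by (auto intro!: less_imp_le)
    qed
    have MinJ: "Min (shift r A) = Min A + r" if "A \<in> set J" "0 \<notin> A" for r A
    proof -
      have "shift r A = (\<lambda>a. a + r) ` A" unfolding shift_def using that(2) by (intro image_cong) auto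
      then show ?thesis using blocks[OF J that(1)] Min_add_commute[of A "\<lambda>x. x" r] by simp
    qed
    have filtJ: "filter (\<lambda>A. 0 \<notin> A) ?J' = map (shift (degr I)) (filter (\<lambda>A. 0 \<notin> A) J)"
      by (simp add: filter_map comp_def sh)
    have "map Min (filter (\<lambda>A. 0 \<notin> A) ?J') = map (\<lambda>x. x + degr I) (map Min (filter (\<lambda>A. 0 \<notin> A) J))"
      unfolding filtJ by (simp add: MinJ)
    then have "sorted (map Min (filter (\<lambda>A. 0 \<notin> A) ?J'))"
      using sK[OF J] by (simp add: sorted_map)
    moreover have "Min A \<le> Min B" if AI: "A \<in> set (filter (\<lambda>A. 0 \<notin> A) I)" and BJ: "B \<in> set (filter (\<lambda>A. 0 \<notin> A) ?J')"
      for A B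
    proof -
      obtain C where "C \<in> set J" "0 \<notin> C" "B = shift (degr I) C" using BJ unfolding filtJ by auto
      then have "n \<le> Min B" using MinJ partial_set_supercomposition_bidegree(1)[OF I] by simp
      moreover have "Min A \<in> A" "A \<subseteq> {0..n}" using blocks[OF I, of A] AI by auto
      ultimately show ?thesis by (meson atLeastAtMost_iff le_trans subsetD)
    qed
    ultimately show ?thesis
      using sK[OF I] by (auto simp: sorted_append)
  qed
  have "merge I J {} = filter (\<lambda>A. 0 \<in> A) I @ filter (\<lambda>A. 0 \<in> A) ?J' @
     sort_key Min (filter (\<lambda>A. 0 \<notin> A) I @ filter (\<lambda>A. 0 \<notin> A) ?J')"
    unfolding merge_def Let_def
    using filt[of ?J' "\<lambda>A. 0 \<in> A"] filt[of ?J' "\<lambda>A. 0 \<notin> A"] filt[of I "\<lambda>A. 0 \<in> A"] filt[of I "\<lambda>A. 0 \<notin> A"]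
    by simp
  then show ?thesis
    unfolding slash_def Let_def sort_key_id_if_sorted[OF sorted] by simp
qed

definition superpartition_shuffle :: "nat set list \<Rightarrow> nat set list \<Rightarrow> nat set list set" where
  "superpartition_shuffle I J =
     {K. (\<exists>M. block_pairing I J M \<and> K = merge I J M) \<and>
         (\<exists>n m. partial_set_supercomposition n m K) \<and> nontrivial K}"

lemma finite_superpartition_shuffle: "finite (superpartition_shuffle I J)"
proof (rule finite_subset)
  show "superpartition_shuffle I J \<subseteq> merge I J ` Pow ({..<length I} \<times> {..<length J})"
    by (auto simp: superpartition_shuffle_def block_pairing_def)
qed auto


section \<open>Monomial functions\<close>

text \<open>
  The pairs \<open>(a, b)\<close> of index words of the terms \<open>\<theta>\<^bsub>a\<^sub>1\<^esub> \<cdots> \<theta>\<^bsub>a\<^sub>m\<^esub> x\<^bsub>b\<^sub>1\<^esub> \<cdots> x\<^bsub>b\<^sub>n\<^esub>\<close> of \<open>m\<^sub>K\<close>. Lists are indexed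
  from 0, whereas blocks contain the positions \<open>1, \<dots>, n\<close>.
\<close>

definition monomial_words :: "nat set list \<Rightarrow> (nat list \<times> nat list) set" where
  "monomial_words K =
     {(a, b). length a = fdegr K \<and> length b = degr K \<and> 0 \<notin> set a \<and> 0 \<notin> set b \<and>
        (\<forall>i\<in>{1..fdegr K}. \<forall>j\<in>{1..degr K}. a ! (i - 1) = b ! (j - 1) \<longleftrightarrow> j \<in> K ! (i - 1) - {0}) \<and>
        (\<forall>i\<in>{1..degr K}. \<forall>j\<in>{1..degr K}. b ! (i - 1) = b ! (j - 1) \<longleftrightarrow> (\<exists>A\<in>set K. i \<in> A \<and> j \<in> A))}"

text \<open>
  The formal sum of infinitely many words is taken coefficientwise; only finitely many words
  contribute to each coefficient.
\<close>

lemma finite_contributing_words: "finite {(a, b) \<in> S. coeff (theta_x_word a b) T w \<noteq> 0}"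
proof (cases "finite T")
  case True
  have "{(a, b) \<in> S. coeff (theta_x_word a b) T w \<noteq> 0} \<subseteq>
      {a. set a \<subseteq> T \<and> length a = card T} \<times> {w}"
    by (auto simp: coeff_theta_x_word distinct_card split: if_splits)
  moreover have "finite ({a. set a \<subseteq> T \<and> length a = card T} \<times> {w})"
    using finite_lists_length_eq[OF True] by simp
  ultimately show ?thesis
    by (rule finite_subset)
qed (simp add: coeff_infinite)

lift_definition monomial_function :: "nat set list \<Rightarrow> superseries" is
  "\<lambda>K T w. \<Sum>(a, b) \<in> {(a, b) \<in> monomial_words K. coeff (theta_x_word a b) T w \<noteq> 0}.
     coeff (theta_x_word a b) T w"
proof -
  fix K
  let ?f = "\<lambda>T w. \<Sum>(a, b) \<in> {(a, b) \<in> monomial_words K. coeff (theta_x_word a b) T w \<noteq> 0}.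
     coeff (theta_x_word a b) T w"
  have "finite T \<and> 0 \<notin> T \<and> 0 \<notin> set w \<and> card T + length w \<le> fdegr K + degr K" if "?f T w \<noteq> 0" for T w
  proof -
    have "{(a, b) \<in> monomial_words K. coeff (theta_x_word a b) T w \<noteq> 0} \<noteq> {}"
      using that by (rule contrapos_nn) (simp only: sum.empty)
    then obtain a b where ab: "(a, b) \<in> monomial_words K" and nz: "coeff (theta_x_word a b) T w \<noteq> 0"
      by blast
    have "distinct a" "0 \<notin> set a" "0 \<notin> set b" "T = set a" "w = b"
      using nz by (simp_all add: coeff_theta_x_word split: if_splits)
    moreover have "length a = fdegr K" "length b = degr K"
      using ab by (simp_all add: monomial_words_def)
    ultimately show ?thesis
      by (simp add: distinct_card)
  qed
  then show "(\<forall>T w. ?f T w \<noteq> 0 \<longrightarrow> finite T \<and> 0 \<notin> T \<and> 0 \<notin> set w) \<and>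
      (\<exists>d. \<forall>T w. ?f T w \<noteq> 0 \<longrightarrow> card T + length w \<le> d)"
    by blast
qed

lemma coeff_monomial_function:
  "coeff (monomial_function K) T w =
     (\<Sum>a \<in> {a. (a, w) \<in> monomial_words K \<and> distinct a \<and> set a = T}. theta_sign a)"
proof -
  have "coeff (monomial_function K) T w =
      (\<Sum>p \<in> (\<lambda>a. (a, w)) ` {a. (a, w) \<in> monomial_words K \<and> distinct a \<and> set a = T}.
        case p of (a, b) \<Rightarrow> coeff (theta_x_word a b) T w)"
    unfolding monomial_function.rep_eq
  proof (rule sum.mono_neutral_cong_left, goal_cases)
    case 1
    show ?case
    proof (rule finite_imageI, cases "finite T")
      case True
      then show "finite {a. (a, w) \<in> monomial_words K \<and> distinct a \<and> set a = T}"
        by (intro finite_subset[OF _ finite_lists_length_eq[OF True, of "card T"]]) (auto simp: distinct_card)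
    next
      case False
      then have "{a. (a, w) \<in> monomial_words K \<and> distinct a \<and> set a = T} = {}" by auto
      then show "finite {a. (a, w) \<in> monomial_words K \<and> distinct a \<and> set a = T}"
        by (simp only: finite.emptyI)
    qed
  next
    case 2
    show ?case by (auto simp: coeff_theta_x_word split: if_splits)
  next
    case 3
    show ?case by auto
  next
    case (4 p)
    then show ?case by simp
  qed
  also have "\<dots> = (\<Sum>a \<in> {a. (a, w) \<in> monomial_words K \<and> distinct a \<and> set a = T}. coeff (theta_x_word a w) T w)"
    by (subst sum.reindex) (auto simp: inj_on_def)
  also have "\<dots> = (\<Sum>a \<in> {a. (a, w) \<in> monomial_words K \<and> distinct a \<and> set a = T}. theta_sign a)"
    by (intro sum.cong refl) (auto simp: coeff_theta_x_word monomial_words_def)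
  finally show ?thesis .
qed

text \<open>The number of inversions of the permutation that sorts the image of \<open>\<theta>\<^sub>T\<close> under \<open>\<sigma>\<close>.\<close>

definition image_inversions :: "(nat \<Rightarrow> nat) \<Rightarrow> nat set \<Rightarrow> nat" where
  "image_inversions \<sigma> T = card {(s, t). s \<in> T \<and> t \<in> T \<and> s < t \<and> \<sigma> t < \<sigma> s}"

lemma theta_sign_map:
  assumes "distinct a" "inj_on \<sigma> (set a)"
  shows "theta_sign (map \<sigma> a) = (-1) ^ image_inversions \<sigma> (set a) * theta_sign a"
  using assms
proof (induction a)
  case Nil
  show ?case by (simp add: image_inversions_def)
next
  case (Cons x a)
  let ?A = "set a"
  let ?P = "{t \<in> ?A. x < t \<and> \<sigma> t < \<sigma> x}" and ?Q = "{t \<in> ?A. t < x \<and> \<sigma> x < \<sigma> t}"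
    and ?R = "{t \<in> ?A. t < x \<and> \<sigma> t < \<sigma> x}"
  have x: "x \<notin> ?A" "\<sigma> x \<notin> \<sigma> ` ?A" "inj_on \<sigma> ?A" using Cons.prems by auto
  have ne: "t \<noteq> x" "\<sigma> t \<noteq> \<sigma> x" if "t \<in> ?A" for t using that x by (auto simp: image_iff)
  have "inversions {\<sigma> x} (\<sigma> ` ?A) = card ((\<lambda>t. (\<sigma> x, \<sigma> t)) ` {t \<in> ?A. \<sigma> t < \<sigma> x})"
    unfolding inversions_def by (rule arg_cong[of _ _ card]) auto
  also have "\<dots> = card {t \<in> ?A. \<sigma> t < \<sigma> x}"
    by (rule card_image) (use x(3) in \<open>auto simp: inj_on_def\<close>)
  also have "{t \<in> ?A. \<sigma> t < \<sigma> x} = ?P \<union> ?R" using ne by (auto simp: neq_iff)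
  also have "card (?P \<union> ?R) = card ?P + card ?R" by (rule card_Un_disjoint) auto
  finally have 1: "inversions {\<sigma> x} (\<sigma> ` ?A) = card ?P + card ?R" .
  have "inversions {x} ?A = card ((\<lambda>t. (x, t)) ` {t \<in> ?A. t < x})"
    unfolding inversions_def by (rule arg_cong[of _ _ card]) auto
  also have "\<dots> = card {t \<in> ?A. t < x}"
    by (rule card_image) (auto simp: inj_on_def)
  also have "{t \<in> ?A. t < x} = ?Q \<union> ?R" using ne by (auto simp: neq_iff)
  also have "card (?Q \<union> ?R) = card ?Q + card ?R" by (rule card_Un_disjoint) auto
  finally have 2: "inversions {x} ?A = card ?Q + card ?R" .
  have eq: "{(s, t). s \<in> insert x ?A \<and> t \<in> insert x ?A \<and> s < t \<and> \<sigma> t < \<sigma> s} =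
      {(s, t). s \<in> ?A \<and> t \<in> ?A \<and> s < t \<and> \<sigma> t < \<sigma> s} \<union> (Pair x ` ?P \<union> (\<lambda>t. (t, x)) ` ?Q)"
    by auto
  have c1: "card ({(s, t). s \<in> ?A \<and> t \<in> ?A \<and> s < t \<and> \<sigma> t < \<sigma> s} \<union> (Pair x ` ?P \<union> (\<lambda>t. (t, x)) ` ?Q)) =
      card {(s, t). s \<in> ?A \<and> t \<in> ?A \<and> s < t \<and> \<sigma> t < \<sigma> s} + card (Pair x ` ?P \<union> (\<lambda>t. (t, x)) ` ?Q)"
  proof (rule card_Un_disjoint)
    show "finite {(s, t). s \<in> ?A \<and> t \<in> ?A \<and> s < t \<and> \<sigma> t < \<sigma> s}"
      by (rule finite_subset[of _ "?A \<times> ?A"]) auto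
  qed (use x(1) in auto)
  have c2: "card (Pair x ` ?P \<union> (\<lambda>t. (t, x)) ` ?Q) = card (Pair x ` ?P) + card ((\<lambda>t. (t, x)) ` ?Q)"
    by (rule card_Un_disjoint) (use x(1) in auto)
  have c3: "card (Pair x ` ?P) = card ?P" "card ((\<lambda>t. (t, x)) ` ?Q) = card ?Q"
    by (rule card_image, rule inj_onI, simp)+
  have 3: "image_inversions \<sigma> (insert x ?A) = image_inversions \<sigma> ?A + (card ?P + card ?Q)"
    unfolding image_inversions_def eq c1 c2 c3 ..
  have sq: "(-1 :: rat) ^ k * (-1) ^ k = 1" for k
    by (simp add: power_mult_distrib[symmetric])
  have IH: "theta_sign (map \<sigma> a) = (-1) ^ image_inversions \<sigma> ?A * theta_sign a"
    using Cons by simp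
  have "theta_sign (map \<sigma> (x # a)) =
      (-1) ^ card ?P * (-1) ^ card ?R * ((-1) ^ image_inversions \<sigma> ?A * theta_sign a)"
    by (simp add: 1 IH power_add)
  also have "\<dots> = (-1) ^ image_inversions \<sigma> ?A * (-1) ^ card ?P * ((-1) ^ card ?Q * (-1) ^ card ?Q)
      * (-1) ^ card ?R * theta_sign a"
    unfolding sq by (simp add: mult_ac)
  also have "\<dots> = (-1) ^ image_inversions \<sigma> (set (x # a)) * theta_sign (x # a)"
    by (simp add: 2 3 power_add mult_ac)
  finally show ?case .
qed

lemma theta_sign_sorted: "sorted a \<Longrightarrow> theta_sign a = 1"
proof (induction a)
  case (Cons i a)
  then have "{(s, t). s \<in> {i} \<and> t \<in> set a \<and> t < s} = {}" by auto
  then have "inversions {i} (set a) = 0" by (simp only: inversions_def card.empty)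
  then show ?case using Cons by simp
qed simp

lemma monomial_function_in_sNCSym:
  "monomial_function K \<in> sNCSym"
  unfolding sNCSym_def mem_Collect_eq
proof (intro allI impI)
  fix \<sigma> N T v
  assume bij: "bij_betw \<sigma> {1..N} {1..N::nat}" and T: "T \<subseteq> {1..N}" and v: "set v \<subseteq> {1..N}"
  have inj: "inj_on \<sigma> {1..N}"
    using bij by (rule bij_betw_imp_inj_on)
  have pos: "0 < \<sigma> i" if "i \<in> {1..N}" for i
    using bij_betwE[OF bij] that by (meson atLeastAtMost_iff less_le_trans zero_less_one)
  have finT: "finite T" using T finite_subset by blast
  have eq: "\<sigma> i = \<sigma> j \<longleftrightarrow> i = j" if "i \<in> {1..N}" "j \<in> {1..N}" for i j
    using inj that by (meson inj_onD)
  have words: "(map \<sigma> a, map \<sigma> b) \<in> monomial_words K \<longleftrightarrow> (a, b) \<in> monomial_words K"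
    if a: "set a \<subseteq> {1..N}" and b: "set b \<subseteq> {1..N}" for a b
  proof -
    have 0: "0 \<notin> \<sigma> ` set c" "0 \<notin> set c" if "set c \<subseteq> {1..N}" for c
      using that pos by fastforce+
    have nth: "c ! i \<in> {1..N}" if "set c \<subseteq> {1..N}" "i < length c" for c i
      using that by (meson nth_mem subsetD)
    show ?thesis
    proof (cases "length a = fdegr K \<and> length b = degr K")
      case True
      then have l: "length a = fdegr K" "length b = degr K" by auto
      have "(map \<sigma> a ! (i - 1) = map \<sigma> b ! (j - 1)) = (a ! (i - 1) = b ! (j - 1))"
        if "i \<in> {1..fdegr K}" "j \<in> {1..degr K}" for i j
      proof -
        have "i - 1 < length a" "j - 1 < length b" using that l by auto
        then show ?thesis by (simp only: nth_map eq[OF nth[OF a] nth[OF b]])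
      qed
      moreover have "(map \<sigma> b ! (i - 1) = map \<sigma> b ! (j - 1)) = (b ! (i - 1) = b ! (j - 1))"
        if "i \<in> {1..degr K}" "j \<in> {1..degr K}" for i j
      proof -
        have "i - 1 < length b" "j - 1 < length b" using that l by auto
        then show ?thesis by (simp only: nth_map eq[OF nth[OF b] nth[OF b]])
      qed
      ultimately show ?thesis
        using 0[OF a] 0[OF b] unfolding monomial_words_def
        by (simp only: mem_Collect_eq prod.case length_map set_map cong: ball_cong)
    qed (auto simp: monomial_words_def)
  qed
  have sgn: "theta_sign (map \<sigma> a) = (-1) ^ image_inversions \<sigma> T * theta_sign a" if "distinct a" "set a = T" for a
    using theta_sign_map[of a \<sigma>] that inj T by (auto intro: inj_on_subset)
  have img: "{a. (a, map \<sigma> v) \<in> monomial_words K \<and> distinct a \<and> set a = \<sigma> ` T} =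
      map \<sigma> ` {a. (a, v) \<in> monomial_words K \<and> distinct a \<and> set a = T}" (is "?L = ?R")
  proof
    show "?R \<subseteq> ?L"
      using words[OF _ v] T inj by (auto simp: distinct_map intro: inj_on_subset)
    show "?L \<subseteq> ?R"
    proof
      fix a assume a: "a \<in> ?L"
      define c where "c = map (the_inv_into {1..N} \<sigma>) a"
      have "\<sigma> (the_inv_into {1..N} \<sigma> i) = i" if "i \<in> set a" for i
        using that a T inj by (auto intro!: f_the_inv_into_f)
      then have ac: "a = map \<sigma> c" by (auto simp: c_def intro!: map_idI[symmetric])
      have "the_inv_into {1..N} \<sigma> (\<sigma> i) = i" if "i \<in> T" for i
        using that T inj by (auto intro!: the_inv_into_f_f)
      then have "set c = T" using a by (auto simp: c_def image_image)
      moreover have "distinct c" using a ac by (simp add: distinct_map)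
      ultimately show "a \<in> ?R"
        using words[of c v] a v T ac by auto
    qed
  qed
  have injmap: "inj_on (map \<sigma>) {a. (a, v) \<in> monomial_words K \<and> distinct a \<and> set a = T}"
  proof (rule inj_onI)
    fix a b
    assume "a \<in> {a. (a, v) \<in> monomial_words K \<and> distinct a \<and> set a = T}"
      "b \<in> {a. (a, v) \<in> monomial_words K \<and> distinct a \<and> set a = T}" "map \<sigma> a = map \<sigma> b"
    then show "a = b"
      using inj_on_map_eq_map[of \<sigma> a b] inj_on_subset[OF inj T] by simp
  qed
  have "coeff (monomial_function K) (\<sigma> ` T) (map \<sigma> v) =
      (\<Sum>a \<in> {a. (a, v) \<in> monomial_words K \<and> distinct a \<and> set a = T}. theta_sign (map \<sigma> a))"
    unfolding coeff_monomial_function img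
    by (simp only: sum.reindex[OF injmap] comp_def)
  also have "\<dots> = (\<Sum>a \<in> {a. (a, v) \<in> monomial_words K \<and> distinct a \<and> set a = T}.
      (-1) ^ image_inversions \<sigma> T * theta_sign a)"
    by (intro sum.cong refl) (simp add: sgn)
  also have "\<dots> = coeff (monomial_function K) T v * (-1) ^ image_inversions \<sigma> T"
    by (simp add: coeff_monomial_function sum_distrib_left mult_ac)
  also have "(-1) ^ image_inversions \<sigma> T =
      coeff (theta_x_word (map \<sigma> (sorted_list_of_set T)) (map \<sigma> v)) (\<sigma> ` T) (map \<sigma> v)"
  proof -
    have "0 \<notin> \<sigma> ` T" "0 \<notin> \<sigma> ` set v" using pos T v by fastforce+
    moreover have "inj_on \<sigma> T" using inj T by (rule inj_on_subset)
    ultimately show ?thesis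
      using finT by (simp add: coeff_theta_x_word distinct_map sgn theta_sign_sorted)
  qed
  finally show "coeff (monomial_function K) (\<sigma> ` T) (map \<sigma> v) = coeff (monomial_function K) T v *
      coeff (theta_x_word (map \<sigma> (sorted_list_of_set T)) (map \<sigma> v)) (\<sigma> ` T) (map \<sigma> v)" .
qed

end

(* A product of a word of m_I and a word of m_J equals, as the x commute with the theta, the
   concatenation of their theta parts followed by that of their x parts. If its theta are distinct,
   then it is a word of m_K for exactly one K: the blocks of a set superpartition carry pairwise
   distinct indices in each word (at most one block is {0}), so the equalities between the indices
   of blocks of I and blocks of J form a block pairing, and K is the merge along it. Summing over all
   merges therefore gives the product. The merges that do not belong to the shuffle have two blocks
   {0}, and exchanging the theta of these two blocks shows that their monomial functions vanish. *)

theory Submission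
  imports Defs
begin

section \<open>Signs of \<open>\<theta>\<close>-words\<close>

text \<open>Signs never have to be compared across the identity. A coefficient of a monomial
  function is a sum of \<open>theta_sign\<close> over orderings of a fixed set of theta, and the
  sign in \<open>conv\<close> is exactly the one that joins orderings for the two factors into one.
  The theorem thus becomes an equality of sets of words, tested by cutting a word after m theta and
  n x. The sum runs over merged lists, so two pairings are compared only when their merges share a
  word. Two obstacles shape the argument. The conditions on words compare x with x and theta with x,
  but never two theta. So a pair of blocks is tested through a nonfermionic member, which always
  owns an x, and a pair of fermionic blocks is settled by the distinctness of the theta. Moreover,
  the shuffle asks for partial set supercompositions, so the bound m + q \<le> n + p + 1 has to be
  derived for each merge without two blocks \<open>{0}\<close>; only then is every merge outside the
  shuffle known to be one whose monomial function vanishes.\<close>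

text \<open>The extra factor counts the inversions across the cut, which is the sign that
  \<open>conv\<close> attaches to a product of two increasing theta words.\<close>

lemma theta_sign_append:
  "distinct (a @ b) \<Longrightarrow>
    theta_sign (a @ b) = (-1) ^ inversions (set a) (set b) * theta_sign a * theta_sign b"
proof (induction a)
  case Nil
  show ?case by simp
next
  case (Cons x a)
  have "inversions {x} (set a \<union> set b) = inversions {x} (set a) + inversions {x} (set b)"
    by (rule inversions_Un_right) (use Cons.prems in auto)
  moreover have "inversions ({x} \<union> set a) (set b) = inversions {x} (set b) + inversions (set a) (set b)"
    by (rule inversions_Un_left) (use Cons.prems in auto)
  ultimately show ?case using Cons by (simp add: power_add)
qed

lemma var_theta_times_theta_word:
  "var_theta x * prod_list (map var_theta a) = (-1) ^ length a * (prod_list (map var_theta a) * var_theta x)"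
proof (induction a)
  case Nil
  show ?case by simp
next
  case (Cons y a)
  have "var_theta x * prod_list (map var_theta (y # a)) = - (var_theta y * (var_theta x * prod_list (map var_theta a)))"
    by (simp add: var_theta_anticommute[of x y] flip: mult.assoc)
  also have "\<dots> = - (var_theta y * (-1) ^ length a) * (prod_list (map var_theta a) * var_theta x)"
    by (simp add: Cons.IH mult.assoc)
  also have "var_theta y * (-1) ^ length a = (-1) ^ length a * var_theta y"
    by (cases "even (length a)") simp_all
  finally show ?case by (simp add: mult.assoc)
qed

text \<open>Moving the left of the two outer letters across \<open>v\<close> costs the same sign on
  both sides, so these signs cancel and only the anticommutation of the two letters remains.\<close>

lemma theta_word_swap:
  "prod_list (map var_theta (u @ x # v @ y # r)) = - prod_list (map var_theta (u @ y # v @ x # r))"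
proof -
  have *: "var_theta s * (prod_list (map var_theta v) * var_theta t) =
      (-1) ^ length v * (prod_list (map var_theta v) * (var_theta s * var_theta t))" for s t
    using var_theta_times_theta_word[of s v] by (metis mult.assoc)
  have "var_theta x * (prod_list (map var_theta v) * var_theta y) =
      - (var_theta y * (prod_list (map var_theta v) * var_theta x))"
    unfolding * var_theta_anticommute[of x y] by simp
  then have "var_theta x * (prod_list (map var_theta v) * (var_theta y * prod_list (map var_theta r))) =
      - (var_theta y * (prod_list (map var_theta v) * (var_theta x * prod_list (map var_theta r))))"
    by (metis mult.assoc mult_minus_left)
  then show ?thesis by (simp add: mult.assoc)
qed

text \<open>The sign of a word with distinct letters is a coefficient of its theta product, so
  anticommutation in the algebra replaces a count of inversions.\<close>

lemma theta_sign_swap: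
  assumes d: "distinct a" and z: "0 \<notin> set a" and ij: "i < j" "j < length a"
  shows "theta_sign (a[i := a ! j, j := a ! i]) = - theta_sign a"
proof -
  define u v r where "u = take i a" and "v = take (j - Suc i) (drop (Suc i) a)" and "r = drop (Suc j) a"
  have "drop (Suc i) a = v @ drop (j - Suc i) (drop (Suc i) a)"
    by (simp only: v_def append_take_drop_id)
  also have "drop (j - Suc i) (drop (Suc i) a) = a ! j # r"
    using ij by (simp add: r_def Cons_nth_drop_Suc)
  finally have a: "a = u @ a ! i # v @ a ! j # r"
    using ij by (metis u_def id_take_nth_drop less_trans)
  have len: "length u = i" "length v = j - Suc i"
    using ij by (auto simp: u_def v_def)
  have swap: "a[i := a ! j, j := a ! i] = u @ a ! j # v @ a ! i # r"
  proof -
    have "i = length u" "j = Suc (length u + length v)"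
      using len ij by simp_all
    then have "(u @ x # v @ y # r)[i := y, j := x] = u @ y # v @ x # r" for x y
      by (simp add: list_update_append)
    then show ?thesis using a by metis
  qed
  let ?b = "u @ a ! j # v @ a ! i # r"
  have "distinct ?b" "set ?b = set a"
    using d ij unfolding swap[symmetric] by simp_all
  then have "theta_sign ?b = coeff (prod_list (map var_theta ?b)) (set a) []"
    using z by (simp only: coeff_theta_word) simp
  also have "\<dots> = - coeff (prod_list (map var_theta a)) (set a) []"
    by (subst (2) a, subst theta_word_swap) (simp add: uminus_superseries.rep_eq)
  also have "\<dots> = - theta_sign a"
    using d z by (simp add: coeff_theta_word)
  finally show ?thesis using swap by simp
qed

section \<open>Words of a monomial function\<close>

text \<open>Positions are counted from 0 from here on, the x at position \<open>u\<close> being the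
  element \<open>Suc u\<close> of a block. As \<open>Suc u\<close> is never 0, the removal of 0 from
  the blocks disappears.\<close>

lemma monomial_words_iff:
  "(a, b) \<in> monomial_words K \<longleftrightarrow>
     length a = fdegr K \<and> length b = degr K \<and> 0 \<notin> set a \<and> 0 \<notin> set b \<and>
     (\<forall>i<fdegr K. \<forall>u<degr K. a ! i = b ! u \<longleftrightarrow> Suc u \<in> K ! i) \<and>
     (\<forall>u<degr K. \<forall>v<degr K. b ! u = b ! v \<longleftrightarrow> (\<exists>A\<in>set K. Suc u \<in> A \<and> Suc v \<in> A))"
proof -
  have *: "{1..l} = Suc ` {..<l}" for l :: nat
    by (simp add: image_Suc_lessThan)
  show ?thesis
    unfolding monomial_words_def * mem_Collect_eq prod.case ball_simps by (simp add: Ball_def)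
qed

text \<open>With the set U of theta and the x-word fixed, these are all the words that contribute to
  one coefficient, each with its own sign; the product formula is reduced to identities between such
  sets.\<close>

definition monomial_thetas :: "nat set list \<Rightarrow> nat set \<Rightarrow> nat list \<Rightarrow> nat list set" where
  "monomial_thetas K T w = {a. (a, w) \<in> monomial_words K \<and> distinct a \<and> set a = T}"

lemma finite_monomial_thetas: "finite T \<Longrightarrow> finite (monomial_thetas K T w)"
  by (rule finite_subset[OF _ finite_lists_length_eq[of T "card T"]])
     (auto simp: monomial_thetas_def distinct_card)

lemma coeff_monomial_function_thetas: "coeff (monomial_function K) T w = sum theta_sign (monomial_thetas K T w)"
  by (simp add: coeff_monomial_function monomial_thetas_def)

lemma coeff_sum: "coeff (sum f A) T w = (\<Sum>x\<in>A. coeff (f x) T w)"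
  by (induction A rule: infinite_finite_induct) (simp_all add: zero_superseries.rep_eq plus_superseries.rep_eq)

text \<open>Exchanging the \<open>\<theta>\<close>s of two blocks \<open>{0}\<close> permutes the words and reverses their signs.\<close>

lemma monomial_function_eq_0:
  assumes ij: "i < j" "j < fdegr K" and K: "K ! i = {0}" "K ! j = {0}"
  shows "monomial_function K = 0"
proof (rule superseries_eqI)
  fix T :: "nat set" and w
  let ?C = "monomial_thetas K T w" and ?s = "\<lambda>a. a[i := a ! j, j := a ! i]"
  have closed: "?s a \<in> ?C" if a: "a \<in> ?C" for a
  proof -
    have len: "length a = fdegr K" and "(a, w) \<in> monomial_words K"
      using a by (auto simp: monomial_thetas_def monomial_words_iff)
    \<comment> \<open>Blocks \<open>{0}\<close> own no x, so neither of the two exchanged indices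
      occurs in \<open>w\<close>, and every condition on the word survives the exchange.\<close>
    then have "(?s a, w) \<in> monomial_words K"
      using ij K unfolding monomial_words_iff
      by (auto simp: nth_list_update)
    then show ?thesis
      using a ij len by (auto simp: monomial_thetas_def)
  qed
  have invol: "?s (?s a) = a" if a: "a \<in> ?C" for a
  proof -
    have "length a = fdegr K" using a by (auto simp: monomial_thetas_def monomial_words_iff)
    then show ?thesis using ij by (auto intro!: nth_equalityI simp: nth_list_update)
  qed
  have sgn: "theta_sign (?s a) = - theta_sign a" if a: "a \<in> ?C" for a
    using a ij by (intro theta_sign_swap) (auto simp: monomial_thetas_def monomial_words_iff)
  \<comment> \<open>A sign-reversing involution makes the sum equal to its own negative, hence 0 in
    the rationals.\<close>
  have "sum theta_sign ?C = (\<Sum>a\<in>?C. - theta_sign a)"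
    by (rule sum.reindex_bij_witness[where i = ?s and j = ?s]) (use closed invol sgn in auto)
  then show "coeff (monomial_function K) T w = coeff 0 T w"
    by (simp add: coeff_monomial_function_thetas sum_negf zero_superseries.rep_eq)
qed

text \<open>An ordering \<open>c\<close> of U encodes a whole term of the convolution: T is the set
  of its first \<open>fdegr K\<close> letters, and \<open>k\<close> must be \<open>degr K\<close>,
  since the words of K have this length. The sums over T, k and the two orderings thus collapse into
  one, and \<open>theta_sign_append\<close> absorbs the sign.\<close>

lemma coeff_monomial_function_times:
  assumes U: "finite U"
  shows "coeff (monomial_function K * monomial_function L) U w =
    (\<Sum>c \<in> {c. distinct c \<and> set c = U \<and>
        (take (fdegr K) c, take (degr K) w) \<in> monomial_words K \<and>
        (drop (fdegr K) c, drop (degr K) w) \<in> monomial_words L}. theta_sign c)"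
proof -
  let ?C = "\<lambda>(T, k). monomial_thetas K T (take k w) \<times> monomial_thetas L (U - T) (drop k w)"
  have "coeff (monomial_function K * monomial_function L) U w =
      (\<Sum>T\<in>Pow U. \<Sum>k\<le>length w. \<Sum>x\<in>?C (T, k). theta_sign (fst x @ snd x))"
    unfolding times_superseries.rep_eq conv_def coeff_monomial_function_thetas
  proof (intro sum.cong refl)
    fix T k
    have "(-1) ^ inversions T (U - T) * sum theta_sign (monomial_thetas K T (take k w)) *
          sum theta_sign (monomial_thetas L (U - T) (drop k w)) =
        (\<Sum>x\<in>?C (T, k). (-1) ^ inversions T (U - T) * theta_sign (fst x) * theta_sign (snd x))"
      unfolding mult.assoc sum_product
      by (simp add: sum.cartesian_product sum_distrib_left split_def)
    also have "\<dots> = (\<Sum>x\<in>?C (T, k). theta_sign (fst x @ snd x))"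
      by (intro sum.cong refl) (auto simp: monomial_thetas_def theta_sign_append)
    finally show "(-1) ^ inversions T (U - T) * sum theta_sign (monomial_thetas K T (take k w)) *
          sum theta_sign (monomial_thetas L (U - T) (drop k w)) =
        (\<Sum>x\<in>?C (T, k). theta_sign (fst x @ snd x))" .
  qed
  also have "\<dots> = (\<Sum>y\<in>Pow U \<times> {..length w}. \<Sum>x\<in>?C y. theta_sign (fst x @ snd x))"
    by (simp add: sum.cartesian_product split_def)
  also have "\<dots> = (\<Sum>(y, x)\<in>Sigma (Pow U \<times> {..length w}) ?C. theta_sign (fst x @ snd x))"
    by (rule sum.Sigma) (use U in \<open>auto intro!: finite_monomial_thetas dest: finite_subset\<close>)
  also have "\<dots> = (\<Sum>c \<in> {c. distinct c \<and> set c = U \<and>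
        (take (fdegr K) c, take (degr K) w) \<in> monomial_words K \<and>
        (drop (fdegr K) c, drop (degr K) w) \<in> monomial_words L}. theta_sign c)"
  proof (rule sum.reindex_bij_witness
      [where j = "\<lambda>(y, x). fst x @ snd x"
         and i = "\<lambda>c. ((set (take (fdegr K) c), degr K), (take (fdegr K) c, drop (fdegr K) c))"], goal_cases)
    case (1 z)
    then show ?case by (auto simp: monomial_thetas_def monomial_words_iff)
  next
    case (2 z)
    obtain T k a a' where z: "z = ((T, k), (a, a'))" by (metis surj_pair)
    have T: "T \<subseteq> U" "k \<le> length w" "distinct a" "set a = T" "distinct a'" "set a' = U - T"
      and a: "(a, take k w) \<in> monomial_words K" and a': "(a', drop k w) \<in> monomial_words L"
      using 2 by (auto simp: z monomial_thetas_def)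
    have l: "length a = fdegr K" "degr K = k"
      using a T(2) by (simp_all add: monomial_words_iff)
    have "distinct (a @ a')" "set (a @ a') = U" using T by auto
    then show ?case using a a' by (simp add: z l(1)[symmetric] l(2))
  next
    case (3 c)
    then show ?case by simp
  next
    case (4 c)
    then have c: "distinct c" "set c = U" and l: "length (take (degr K) w) = degr K"
      by (auto simp: monomial_words_iff)
    have "distinct (take (fdegr K) c @ drop (fdegr K) c)" "set (take (fdegr K) c @ drop (fdegr K) c) = U"
      using c by simp_all
    \<comment> \<open>Distinctness of \<open>c\<close> turns the letters of its tail into exactly
      the complement of T in U.\<close>
    then have "set (take (fdegr K) c) \<subseteq> U" "U - set (take (fdegr K) c) = set (drop (fdegr K) c)"
      unfolding distinct_append set_append by blast+
    moreover have "degr K \<le> length w" using l by simp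
    ultimately show ?case using 4 by (simp add: monomial_thetas_def)
  next
    case (5 z)
    then show ?case by auto
  qed
  finally show ?thesis .
qed

section \<open>Blocks of supercompositions\<close>

lemma partial_set_supercompositionD:
  assumes "partial_set_supercomposition n m K"
  shows "m \<le> length K"
    and "i < length K \<Longrightarrow> K ! i \<noteq> {}"
    and "i < length K \<Longrightarrow> u \<in> K ! i \<Longrightarrow> u \<le> n"
    and "i < length K \<Longrightarrow> finite (K ! i)"
    and "u < n \<Longrightarrow> \<exists>i<length K. Suc u \<in> K ! i"
    and "i < length K \<Longrightarrow> j < length K \<Longrightarrow> Suc u \<in> K ! i \<Longrightarrow> Suc u \<in> K ! j \<Longrightarrow> i = j"
    and "i < length K \<Longrightarrow> 0 \<in> K ! i \<longleftrightarrow> i < m"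
proof -
  have K: "m \<le> length K" "\<forall>A\<in>set K. A \<noteq> {} \<and> A \<subseteq> {0..n}" "(\<Union>A\<in>set K. A - {0}) = {1..n}"
    "\<forall>i<length K. \<forall>j<length K. i \<noteq> j \<longrightarrow> K ! i \<inter> K ! j \<subseteq> {0}"
    "\<forall>i<length K. 0 \<in> K ! i \<longleftrightarrow> i < m"
    using assms unfolding partial_set_supercomposition_def by - (elim conjE, assumption)+
  show "m \<le> length K" by (fact K)
  show "K ! i \<noteq> {}" if "i < length K" using K(2) that by simp
  show le: "u \<le> n" if "i < length K" "u \<in> K ! i" for i u
    using K(2) that by (meson atLeastAtMost_iff nth_mem subsetD)
  show "finite (K ! i)" if "i < length K"
    using le[OF that] by (meson finite_nat_set_iff_bounded_le)
  show "\<exists>i<length K. Suc u \<in> K ! i" if "u < n"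
  proof -
    have "Suc u \<in> (\<Union>A\<in>set K. A - {0})" using that unfolding K(3) by simp
    then show ?thesis by (auto simp: in_set_conv_nth)
  qed
  show "i = j" if "i < length K" "j < length K" "Suc u \<in> K ! i" "Suc u \<in> K ! j"
    using K(4) that by blast
  show "0 \<in> K ! i \<longleftrightarrow> i < m" if "i < length K" using K(5) that by simp
qed

lemma partial_set_supercomposition_same_block:
  assumes "partial_set_supercomposition n m K"
  shows "(\<exists>A\<in>set K. u \<in> A \<and> v \<in> A) \<longleftrightarrow> (\<exists>i<length K. u \<in> K ! i \<and> v \<in> K ! i)"
  by (metis in_set_conv_nth)

text \<open>Provides an x whose index can stand for the block in comparisons; for a fermionic block
  its theta plays this role.\<close>

lemma nonfermionic_block_nonempty:
  assumes "partial_set_supercomposition n m K" "i < length K" "m \<le> i"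
  obtains u where "u < n" "Suc u \<in> K ! i"
proof -
  have "0 \<notin> K ! i" using partial_set_supercompositionD(7)[OF assms(1,2)] assms(3) by simp
  moreover obtain v where "v \<in> K ! i" using partial_set_supercompositionD(2)[OF assms(1,2)] by blast
  ultimately obtain u where "Suc u \<in> K ! i" by (metis not0_implies_Suc)
  moreover have "u < n" using partial_set_supercompositionD(3)[OF assms(1,2) calculation] by simp
  ultimately show ?thesis by (rule that[rotated])
qed

text \<open>The common index of all variables of a word that belong to the \<open>i\<close>-th block.\<close>

definition block_value :: "nat set list \<Rightarrow> nat list \<Rightarrow> nat list \<Rightarrow> nat \<Rightarrow> nat" where
  "block_value K a b i = (if 0 \<in> K ! i then a ! i else b ! (Min (K ! i) - 1))"

text \<open>For a fermionic block this is the condition that links its theta to the x. Otherwise the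
  x at the minimum of the block represents it, and disjointness of blocks turns sharing a block with
  that x into membership.\<close>

lemma eq_block_value_iff:
  assumes K: "partial_set_supercomposition n m K" and ab: "(a, b) \<in> monomial_words K"
    and i: "i < length K" and u: "u < n"
  shows "b ! u = block_value K a b i \<longleftrightarrow> Suc u \<in> K ! i"
proof (cases "i < m")
  case True
  then show ?thesis
    using partial_set_supercompositionD(7)[OF K i] ab u partial_set_supercomposition_bidegree[OF K]
    unfolding block_value_def monomial_words_iff by (auto simp: eq_commute)
next
  case False
  then have 0: "0 \<notin> K ! i" using partial_set_supercompositionD(7)[OF K i] by simp
  have "Min (K ! i) \<in> K ! i" using partial_set_supercompositionD(2,4)[OF K i] by simp
  then obtain v where v: "Min (K ! i) = Suc v" "Suc v \<in> K ! i" using 0 by (metis not0_implies_Suc)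
  have "v < n" using partial_set_supercompositionD(3)[OF K i v(2)] by simp
  then have "b ! u = b ! v \<longleftrightarrow> (\<exists>j<length K. Suc u \<in> K ! j \<and> Suc v \<in> K ! j)"
    using ab u partial_set_supercomposition_bidegree[OF K]
    unfolding monomial_words_iff partial_set_supercomposition_same_block[OF K] by simp
  also have "\<dots> \<longleftrightarrow> Suc u \<in> K ! i"
    using v i partial_set_supercompositionD(6)[OF K] by blast
  finally show ?thesis using 0 v by (simp add: block_value_def)
qed

lemma set_superpartition_psc: "set_superpartition n m I \<Longrightarrow> partial_set_supercomposition n m I"
  by (simp add: set_superpartition_def)

lemma set_superpartition_distinct: "set_superpartition n m I \<Longrightarrow> distinct I"
  unfolding set_superpartition_def distinct_conv_nth by (metis linorder_neqE_nat)

text \<open>By \<open>eq_block_value_iff\<close>, blocks with the same value have the same positive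
  elements. One such element identifies the block; if there is none, both blocks are
  \<open>{0}\<close>, which a list with distinct entries contains only once.\<close>

lemma inj_on_block_value:
  assumes I: "set_superpartition n m I" and ab: "(a, b) \<in> monomial_words I"
  shows "inj_on (block_value I a b) {..<length I}"
proof (rule inj_onI)
  note psc = set_superpartition_psc[OF I]
  fix i j assume ij: "i \<in> {..<length I}" "j \<in> {..<length I}" and eq: "block_value I a b i = block_value I a b j"
  have u: "Suc u \<in> I ! i \<longleftrightarrow> Suc u \<in> I ! j" for u
    using eq_block_value_iff[OF psc ab, of i u] eq_block_value_iff[OF psc ab, of j u] eq ij
      partial_set_supercompositionD(3)[OF psc] by (metis Suc_le_lessD lessThan_iff)
  show "i = j"
  proof (cases "\<exists>u. Suc u \<in> I ! i")
    case True
    then show ?thesis using u ij partial_set_supercompositionD(6)[OF psc] by blast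
  next
    case False
    then have "I ! i \<subseteq> {0}" "I ! j \<subseteq> {0}" using u by (metis not0_implies_Suc singleton_iff subsetI)+
    then have "I ! i = I ! j" using ij partial_set_supercompositionD(2)[OF psc] by (metis lessThan_iff subset_singletonD)
    then show ?thesis using ij set_superpartition_distinct[OF I] by (simp add: nth_eq_iff_index_eq)
  qed
qed

lemma eq_zero_block: "A \<noteq> {} \<Longrightarrow> (\<And>u. Suc u \<notin> A) \<Longrightarrow> A = {0}"
  by (metis not0_implies_Suc equals0I subsetI subset_singletonD singleton_iff)

lemma nontrivial_iff: "nontrivial K \<longleftrightarrow> (\<forall>i<length K. \<forall>j<length K. K ! i = {0} \<longrightarrow> K ! j = {0} \<longrightarrow> i = j)"
  unfolding nontrivial_def length_filter_conv_card One_nat_def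
  by (subst card_le_Suc0_iff_eq) auto

lemma zero_in_shift [simp]: "0 \<in> shift r A \<longleftrightarrow> 0 \<in> A"
  by (auto simp: shift_def image_iff)

lemma Suc_in_shift: "Suc u \<in> shift r A \<longleftrightarrow> r \<le> u \<and> Suc (u - r) \<in> A"
proof
  assume "Suc u \<in> shift r A"
  then obtain a where "a \<in> A" "a \<noteq> 0" "Suc u = a + r"
    unfolding shift_def by (auto split: if_splits)
  then show "r \<le> u \<and> Suc (u - r) \<in> A" by (cases a) auto
next
  assume "r \<le> u \<and> Suc (u - r) \<in> A"
  then show "Suc u \<in> shift r A"
    unfolding shift_def by (intro image_eqI[of _ _ "Suc (u - r)"]) auto
qed

lemma filter_fermionic:
  assumes "partial_set_supercomposition d e K"
  shows "filter (\<lambda>i. 0 \<in> K ! i) [0..<length K] = [0..<e]"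
proof -
  note D = partial_set_supercompositionD[OF assms]
  have "[0..<length K] = [0..<e] @ [e..<length K]"
    using D(1) by (metis le_add_diff_inverse upt_add_eq_append zero_le)
  moreover have "filter (\<lambda>i. 0 \<in> K ! i) [0..<e] = [0..<e]" using D(1,7) by simp
  moreover have "filter (\<lambda>i. 0 \<in> K ! i) [e..<length K] = []" using D(1,7) by (simp add: filter_empty_conv)
  ultimately show ?thesis by simp
qed

section \<open>Merged supercompositions\<close>

locale superpartition_pair =
  fixes I J :: "nat set list" and n m p q :: nat
  assumes I: "set_superpartition n m I" and J: "set_superpartition p q J"
begin

lemmas pscI = set_superpartition_psc[OF I] and pscJ = set_superpartition_psc[OF J]
lemmas blocksI = partial_set_supercompositionD[OF pscI] and blocksJ = partial_set_supercompositionD[OF pscJ]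
lemmas bidegI [simp] = partial_set_supercomposition_bidegree[OF pscI]
lemmas bidegJ [simp] = partial_set_supercomposition_bidegree[OF pscJ]

text \<open>\<open>left\<close> and \<open>right\<close> reproduce the local functions of
  \<open>merge\<close> as constants of the locale. Together they describe each united block twice,
  once from either factor.\<close>

definition left :: "(nat \<times> nat) set \<Rightarrow> nat \<Rightarrow> nat set" where
  "left M i = I ! i \<union> \<Union>{shift n (J ! j) | j. (i, j) \<in> M}"

definition right :: "(nat \<times> nat) set \<Rightarrow> nat \<Rightarrow> nat set" where
  "right M j = shift n (J ! j) \<union> \<Union>{I ! i | i. (i, j) \<in> M}"

definition unfermionic :: "(nat \<times> nat) set \<Rightarrow> nat set list" where
  "unfermionic M = map (left M) (filter (\<lambda>i. 0 \<notin> left M i) [0..<length I]) @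
     map (right M) (filter (\<lambda>j. 0 \<notin> J ! j \<and> j \<notin> snd ` M) [0..<length J])"

text \<open>The fermionic blocks are the first m of I and the first q of J, so the filters become
  initial segments and the positions in the merged list become explicit.\<close>

lemma merge_eq:
  assumes M: "block_pairing I J M"
  shows "merge I J M = map (left M) [0..<m] @ map (right M) [0..<q] @ sort_key Min (unfermionic M)"
proof -
  let ?J' = "map (shift n) J"
  have lt: "j < length J" if "(i, j) \<in> M" for i j using M that by (auto simp: block_pairing_def)
  have l: "(\<lambda>i. I ! i \<union> \<Union>{?J' ! j | j. (i, j) \<in> M}) = left M"
    unfolding left_def using lt by (intro ext arg_cong2[of _ _ _ _ "(\<union>)"] arg_cong[of _ _ Union]) force+
  have r: "?J' ! j \<union> \<Union>{I ! i | i. (i, j) \<in> M} = right M j" if "j < length J" for j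
    using that by (simp add: right_def)
  have f: "filter (\<lambda>j. 0 \<in> ?J' ! j) [0..<length J] = [0..<q]"
    unfolding filter_fermionic[OF pscJ, symmetric] by (intro filter_cong refl) auto
  have g: "filter (\<lambda>j. 0 \<notin> ?J' ! j \<and> j \<notin> snd ` M) [0..<length J] =
      filter (\<lambda>j. 0 \<notin> J ! j \<and> j \<notin> snd ` M) [0..<length J]"
    by (intro filter_cong refl) auto
  have "map (\<lambda>j. ?J' ! j \<union> \<Union>{I ! i | i. (i, j) \<in> M}) [0..<q] = map (right M) [0..<q]"
    using blocksJ(1) r by simp
  moreover have "map (\<lambda>j. ?J' ! j \<union> \<Union>{I ! i | i. (i, j) \<in> M}) (filter (\<lambda>j. 0 \<notin> J ! j \<and> j \<notin> snd ` M) [0..<length J])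
      = map (right M) (filter (\<lambda>j. 0 \<notin> J ! j \<and> j \<notin> snd ` M) [0..<length J])"
    using r by simp
  ultimately show ?thesis
    unfolding merge_def Let_def bidegI l f g filter_fermionic[OF pscI] unfermionic_def
    by (simp only: map_append fun_cong[OF l])
qed

section \<open>Blocks and elements of the merge along a fixed pairing\<close>

context
  fixes M assumes M: "block_pairing I J M"
begin

lemma pairing_less: "(i, j) \<in> M \<Longrightarrow> i < length I \<and> j < length J"
  using M unfolding block_pairing_def by blast

lemma pairing:
  shows "(i, j) \<in> M \<Longrightarrow> i < length I" "(i, j) \<in> M \<Longrightarrow> j < length J"
    and "(i, j) \<in> M \<Longrightarrow> (i, j') \<in> M \<Longrightarrow> j = j'" "(i, j) \<in> M \<Longrightarrow> (i', j) \<in> M \<Longrightarrow> i = i'"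
    and "(i, j) \<in> M \<Longrightarrow> m \<le> i \<or> q \<le> j"
proof -
  have inj: "inj_on fst M" "inj_on snd M" and "\<forall>(i, j)\<in>M. \<not> (0 \<in> I ! i \<and> 0 \<in> J ! j)"
    using M by (simp_all add: block_pairing_def)
  then have nf: "(i, j) \<in> M \<Longrightarrow> \<not> (0 \<in> I ! i \<and> 0 \<in> J ! j)" by blast
  show "(i, j) \<in> M \<Longrightarrow> i < length I" by (simp add: pairing_less)
  show "(i, j) \<in> M \<Longrightarrow> j < length J" by (simp add: pairing_less)
  show "(i, j) \<in> M \<Longrightarrow> (i, j') \<in> M \<Longrightarrow> j = j'"
    using inj_onD[OF inj(1), of "(i, j)" "(i, j')"] by simp
  show "(i, j) \<in> M \<Longrightarrow> (i', j) \<in> M \<Longrightarrow> i = i'"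
    using inj_onD[OF inj(2), of "(i, j)" "(i', j)"] by simp
  show "(i, j) \<in> M \<Longrightarrow> m \<le> i \<or> q \<le> j"
    using nf pairing_less[of i j] blocksI(7)[of i] blocksJ(7)[of j] by auto
qed

lemma zero_in_left:
  assumes "i < length I" shows "0 \<in> left M i \<longleftrightarrow> i < m \<or> (\<exists>j<q. (i, j) \<in> M)"
proof -
  have "0 \<in> left M i \<longleftrightarrow> 0 \<in> I ! i \<or> (\<exists>j. (i, j) \<in> M \<and> 0 \<in> J ! j)"
    unfolding left_def by auto
  moreover have "(i, j) \<in> M \<and> 0 \<in> J ! j \<longleftrightarrow> (i, j) \<in> M \<and> j < q" for j
    using blocksJ(7)[of j] pairing(2)[of i j] by blast
  ultimately show ?thesis using blocksI(7)[OF assms] by blast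
qed

lemma zero_in_right:
  assumes "j < length J" shows "0 \<in> right M j \<longleftrightarrow> j < q \<or> (\<exists>i<m. (i, j) \<in> M)"
proof -
  have "0 \<in> right M j \<longleftrightarrow> 0 \<in> J ! j \<or> (\<exists>i. (i, j) \<in> M \<and> 0 \<in> I ! i)"
    unfolding right_def by auto
  moreover have "(i, j) \<in> M \<and> 0 \<in> I ! i \<longleftrightarrow> (i, j) \<in> M \<and> i < m" for i
    using blocksI(7)[of i] pairing(1)[of i j] by blast
  ultimately show ?thesis using blocksJ(7)[OF assms] by blast
qed

text \<open>Each block has at most one partner, so both unions consist of a single set.\<close>

lemma left_eq_right:
  assumes "(i, j) \<in> M" shows "left M i = right M j"
proof -
  have "{shift n (J ! j') | j'. (i, j') \<in> M} = {shift n (J ! j)}" "{I ! i' | i'. (i', j) \<in> M} = {I ! i}"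
    using assms pairing(3)[OF assms] pairing(4)[OF assms] by blast+
  then show ?thesis unfolding left_def right_def by (simp add: Un_commute)
qed

lemma Suc_notin_left_block: "i < length I \<Longrightarrow> Suc (n + v) \<notin> I ! i"
  using blocksI(3)[of i "Suc (n + v)"] by auto

text \<open>The number n separates the factors: blocks of I have no element above n, and shifted
  blocks of J have none in 1, ..., n. The later case splits on \<open>u < n\<close> rest on
  this.\<close>

lemma Suc_in_left:
  assumes i: "i < length I"
  shows "u < n \<Longrightarrow> Suc u \<in> left M i \<longleftrightarrow> Suc u \<in> I ! i"
    and "Suc (n + v) \<in> left M i \<longleftrightarrow> (\<exists>j. (i, j) \<in> M \<and> Suc v \<in> J ! j)"
  using Suc_notin_left_block[OF i, of v] unfolding left_def by (auto simp: Suc_in_shift)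

lemma Suc_in_right:
  shows "u < n \<Longrightarrow> Suc u \<in> right M j \<longleftrightarrow> (\<exists>i. (i, j) \<in> M \<and> Suc u \<in> I ! i)"
    and "Suc (n + v) \<in> right M j \<longleftrightarrow> Suc v \<in> J ! j"
  unfolding right_def by (auto simp: Suc_in_shift Suc_notin_left_block dest: pairing(1))

lemma set_unfermionic:
  "set (unfermionic M) = left M ` {i. i < length I \<and> 0 \<notin> left M i} \<union>
     right M ` {j. j < length J \<and> 0 \<notin> J ! j \<and> j \<notin> snd ` M}"
  by (auto simp: unfermionic_def)

lemma set_merge: "set (merge I J M) = left M ` {..<length I} \<union> right M ` {..<length J}" (is "_ = ?R")
proof
  show "set (merge I J M) \<subseteq> ?R"
    using blocksI(1) blocksJ(1) by (auto simp: merge_eq[OF M] set_unfermionic)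
  have l: "left M i \<in> set (merge I J M)" if i: "i < length I" for i
  proof (cases "0 \<in> left M i")
    case True
    \<comment> \<open>A nonfermionic block of I that is united with a fermionic block of J is listed
      only in the place of the latter, as a \<open>right\<close> block.\<close>
    then consider "i < m" | j where "j < q" "left M i = right M j"
      using zero_in_left[OF i] left_eq_right by blast
    then show ?thesis
      by cases (simp_all add: merge_eq[OF M])
  qed (use i in \<open>auto simp: merge_eq[OF M] set_unfermionic\<close>)
  have r: "right M j \<in> set (merge I J M)" if "j < length J" for j
  proof (cases "\<exists>i. (i, j) \<in> M")
    case True
    then obtain i where "(i, j) \<in> M" by blast
    then show ?thesis using l[of i] pairing(1)[of i j] left_eq_right[of i j] by simp
  next
    case False
    then have "j \<notin> snd ` M" by auto
    then show ?thesis using that blocksJ(7)[OF that] by (auto simp: merge_eq[OF M] set_unfermionic)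
  qed
  show "?R \<subseteq> set (merge I J M)" using l r by auto
qed

lemma zero_notin_unfermionic: "A \<in> set (unfermionic M) \<Longrightarrow> 0 \<notin> A"
proof -
  assume "A \<in> set (unfermionic M)"
  moreover have "0 \<notin> right M j" if "j < length J" "0 \<notin> J ! j" "j \<notin> snd ` M" for j
    using that unfolding right_def by force
  ultimately show ?thesis by (auto simp: set_unfermionic)
qed

lemma fdegr_merge: "fdegr (merge I J M) = m + q"
proof -
  have "filter (\<lambda>A. 0 \<in> A) (map (left M) [0..<m]) = map (left M) [0..<m]"
    "filter (\<lambda>A. 0 \<in> A) (map (right M) [0..<q]) = map (right M) [0..<q]"
    using blocksI(1) blocksJ(1) by (simp_all add: filter_id_conv zero_in_left zero_in_right)
  moreover have "filter (\<lambda>A. 0 \<in> A) (sort_key Min (unfermionic M)) = []"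
    using zero_notin_unfermionic by (simp add: filter_empty_conv)
  ultimately show ?thesis by (simp add: fdegr_def merge_eq[OF M])
qed

lemma positive_part_merge: "(\<Union>A\<in>set (merge I J M). A - {0}) = {1..n + p}"
proof -
  have *: "Suc u \<in> (\<Union>A\<in>set (merge I J M). A - {0}) \<longleftrightarrow> Suc u \<in> {1..n + p}" for u
  proof (cases "u < n")
    case True
    then obtain i where i: "i < length I" "Suc u \<in> I ! i" using blocksI(5) by blast
    then have "Suc u \<in> left M i" using Suc_in_left(1) True by simp
    then have "Suc u \<in> (\<Union>A\<in>set (merge I J M). A - {0})" unfolding set_merge using i by blast
    then show ?thesis using True by simp
  next
    case False
    then obtain v where u: "u = n + v" by (metis le_iff_add not_less)
    have "Suc u \<in> (\<Union>A\<in>set (merge I J M). A - {0}) \<longleftrightarrow>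
        (\<exists>i<length I. Suc u \<in> left M i) \<or> (\<exists>j<length J. Suc u \<in> right M j)"
      unfolding set_merge by blast
    also have "\<dots> \<longleftrightarrow> (\<exists>i<length I. \<exists>j. (i, j) \<in> M \<and> Suc v \<in> J ! j) \<or> (\<exists>j<length J. Suc v \<in> J ! j)"
      unfolding u by (simp add: Suc_in_left(2) Suc_in_right(2) cong: conj_cong)
    also have "\<dots> \<longleftrightarrow> (\<exists>j<length J. Suc v \<in> J ! j)"
      using pairing(2) by blast
    also have "\<dots> \<longleftrightarrow> v < p" using blocksJ(3)[of _ "Suc v"] blocksJ(5)[of v] Suc_le_eq by blast
    finally show ?thesis using u by (simp add: Suc_le_eq)
  qed
  have "x \<in> (\<Union>A\<in>set (merge I J M). A - {0}) \<longleftrightarrow> x \<in> {1..n + p}" for x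
    using *[of "x - 1"] by (cases x) auto
  then show ?thesis by blast
qed

lemma degr_merge: "degr (merge I J M) = n + p"
  unfolding degr_def positive_part_merge by simp

section \<open>Words of a merge\<close>

lemma nth_merge:
  shows "i < m \<Longrightarrow> merge I J M ! i = left M i" "j < q \<Longrightarrow> merge I J M ! (m + j) = right M j"
  by (simp_all add: merge_eq[OF M] nth_append)

text \<open>A pairing never joins two blocks of the same factor, so letters of one factor share a
  block exactly when they did before. Letters of different factors can meet only in a chosen
  union.\<close>

lemma same_block_merge:
  shows "u < n \<Longrightarrow> v < n \<Longrightarrow> (\<exists>A\<in>set (merge I J M). Suc u \<in> A \<and> Suc v \<in> A) \<longleftrightarrow>
      (\<exists>i<length I. Suc u \<in> I ! i \<and> Suc v \<in> I ! i)"
    and "u < n \<Longrightarrow> (\<exists>A\<in>set (merge I J M). Suc u \<in> A \<and> Suc (n + v) \<in> A) \<longleftrightarrow>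
      (\<exists>(i, j)\<in>M. Suc u \<in> I ! i \<and> Suc v \<in> J ! j)"
    and "(\<exists>A\<in>set (merge I J M). Suc (n + u) \<in> A \<and> Suc (n + v) \<in> A) \<longleftrightarrow>
      (\<exists>j<length J. Suc u \<in> J ! j \<and> Suc v \<in> J ! j)"
proof -
  have ex: "(\<exists>A\<in>set (merge I J M). P A) \<longleftrightarrow> (\<exists>i<length I. P (left M i)) \<or> (\<exists>j<length J. P (right M j))" for P
    unfolding set_merge by auto
  show "(\<exists>A\<in>set (merge I J M). Suc u \<in> A \<and> Suc v \<in> A) \<longleftrightarrow>
      (\<exists>i<length I. Suc u \<in> I ! i \<and> Suc v \<in> I ! i)" if "u < n" "v < n"
  proof -
    have "(\<exists>j<length J. Suc u \<in> right M j \<and> Suc v \<in> right M j) \<Longrightarrow> (\<exists>i<length I. Suc u \<in> I ! i \<and> Suc v \<in> I ! i)"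
      unfolding Suc_in_right(1)[OF that(1)] Suc_in_right(1)[OF that(2)] using pairing(1,4) by blast
    then show ?thesis
      unfolding ex using Suc_in_left(1) that by blast
  qed
  show "(\<exists>A\<in>set (merge I J M). Suc u \<in> A \<and> Suc (n + v) \<in> A) \<longleftrightarrow>
      (\<exists>(i, j)\<in>M. Suc u \<in> I ! i \<and> Suc v \<in> J ! j)" if "u < n"
  proof -
    have "(\<exists>j<length J. Suc u \<in> right M j \<and> Suc (n + v) \<in> right M j) \<longleftrightarrow> (\<exists>(i, j)\<in>M. Suc u \<in> I ! i \<and> Suc v \<in> J ! j)"
      unfolding Suc_in_right(1)[OF that] Suc_in_right(2) using pairing(2) by blast
    moreover have "(\<exists>i<length I. Suc u \<in> left M i \<and> Suc (n + v) \<in> left M i) \<longleftrightarrow> (\<exists>(i, j)\<in>M. Suc u \<in> I ! i \<and> Suc v \<in> J ! j)"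
      using Suc_in_left(1)[OF _ that] Suc_in_left(2) pairing(1) by blast
    ultimately show ?thesis unfolding ex by blast
  qed
  show "(\<exists>A\<in>set (merge I J M). Suc (n + u) \<in> A \<and> Suc (n + v) \<in> A) \<longleftrightarrow>
      (\<exists>j<length J. Suc u \<in> J ! j \<and> Suc v \<in> J ! j)"
  proof -
    have "(\<exists>i<length I. Suc (n + u) \<in> left M i \<and> Suc (n + v) \<in> left M i) \<Longrightarrow> (\<exists>j<length J. Suc u \<in> J ! j \<and> Suc v \<in> J ! j)"
      using Suc_in_left(2) pairing(2,3) by blast
    then show ?thesis unfolding ex Suc_in_right(2) by blast
  qed
qed

text \<open>Every condition compares two letters and is sorted by the factors they come from.
  Comparisons within a factor give back the words of I and J; only the mixed ones depend on the
  pairing.\<close>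

lemma merge_word_iff:
  assumes len: "length a = m" "length b = n" "length a' = q" "length b' = p"
  shows "(a @ a', b @ b') \<in> monomial_words (merge I J M) \<longleftrightarrow>
    (a, b) \<in> monomial_words I \<and> (a', b') \<in> monomial_words J \<and>
    (\<forall>i<m. \<forall>v<p. a ! i = b' ! v \<longleftrightarrow> (\<exists>j. (i, j) \<in> M \<and> Suc v \<in> J ! j)) \<and>
    (\<forall>j<q. \<forall>u<n. a' ! j = b ! u \<longleftrightarrow> (\<exists>i. (i, j) \<in> M \<and> Suc u \<in> I ! i)) \<and>
    (\<forall>u<n. \<forall>v<p. b ! u = b' ! v \<longleftrightarrow> (\<exists>(i, j)\<in>M. Suc u \<in> I ! i \<and> Suc v \<in> J ! j))"
proof -
  let ?K = "merge I J M"
  have all: "(\<forall>i<k + l. P i) \<longleftrightarrow> (\<forall>i<k. P i) \<and> (\<forall>i<l. P (k + i))" for k l :: nat and P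
  proof -
    have "P i" if "\<forall>i<k. P i" "\<forall>i<l. P (k + i)" "i < k + l" for i
      using that(1) that(2)[rule_format, of "i - k"] that(3) by (cases "i < k") auto
    then show ?thesis by auto
  qed
  have i: "i < m \<Longrightarrow> i < length I" for i using blocksI(1) by simp
  have thetas: "(\<forall>i<m + q. \<forall>u<n + p. (a @ a') ! i = (b @ b') ! u \<longleftrightarrow> Suc u \<in> ?K ! i) \<longleftrightarrow>
      (\<forall>i<m. \<forall>u<n. a ! i = b ! u \<longleftrightarrow> Suc u \<in> I ! i) \<and>
      (\<forall>i<m. \<forall>v<p. a ! i = b' ! v \<longleftrightarrow> (\<exists>j. (i, j) \<in> M \<and> Suc v \<in> J ! j)) \<and>
      (\<forall>j<q. \<forall>u<n. a' ! j = b ! u \<longleftrightarrow> (\<exists>i. (i, j) \<in> M \<and> Suc u \<in> I ! i)) \<and>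
      (\<forall>j<q. \<forall>v<p. a' ! j = b' ! v \<longleftrightarrow> Suc v \<in> J ! j)"
    unfolding all imp_conjR all_conj_distrib conj_assoc
    by (simp add: len nth_append nth_merge i Suc_in_left Suc_in_right conj_ac)
  \<comment> \<open>The relation is symmetric, so comparing an x of the second factor with one of
    the first repeats the mixed case.\<close>
  define E where "E u v \<longleftrightarrow> ((b @ b') ! u = (b @ b') ! v \<longleftrightarrow> (\<exists>A\<in>set ?K. Suc u \<in> A \<and> Suc v \<in> A))" for u v
  have E_sym: "E u v \<longleftrightarrow> E v u" for u v
    unfolding E_def by (metis (no_types))
  have E: "u < n \<Longrightarrow> v < n \<Longrightarrow> E u v \<longleftrightarrow> (b ! u = b ! v \<longleftrightarrow> (\<exists>i<length I. Suc u \<in> I ! i \<and> Suc v \<in> I ! i))"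
    "u < n \<Longrightarrow> E u (n + v) \<longleftrightarrow> (b ! u = b' ! v \<longleftrightarrow> (\<exists>(i, j)\<in>M. Suc u \<in> I ! i \<and> Suc v \<in> J ! j))"
    "E (n + u) (n + v) \<longleftrightarrow> (b' ! u = b' ! v \<longleftrightarrow> (\<exists>j<length J. Suc u \<in> J ! j \<and> Suc v \<in> J ! j))" for u v
    unfolding E_def by (simp_all only: same_block_merge) (simp_all add: len nth_append)
  have "(\<forall>u<n + p. \<forall>v<n + p. E u v) \<longleftrightarrow>
      (\<forall>u<n. \<forall>v<n. E u v) \<and> (\<forall>u<n. \<forall>v<p. E u (n + v)) \<and> (\<forall>u<p. \<forall>v<p. E (n + u) (n + v))"
    unfolding all using E_sym by blast
  also have "\<dots> \<longleftrightarrow>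
      (\<forall>u<n. \<forall>v<n. b ! u = b ! v \<longleftrightarrow> (\<exists>i<length I. Suc u \<in> I ! i \<and> Suc v \<in> I ! i)) \<and>
      (\<forall>u<n. \<forall>v<p. b ! u = b' ! v \<longleftrightarrow> (\<exists>(i, j)\<in>M. Suc u \<in> I ! i \<and> Suc v \<in> J ! j)) \<and>
      (\<forall>u<p. \<forall>v<p. b' ! u = b' ! v \<longleftrightarrow> (\<exists>j<length J. Suc u \<in> J ! j \<and> Suc v \<in> J ! j))"
    by (simp add: E)
  finally have words: "(\<forall>u<n + p. \<forall>v<n + p. (b @ b') ! u = (b @ b') ! v \<longleftrightarrow> (\<exists>A\<in>set ?K. Suc u \<in> A \<and> Suc v \<in> A)) \<longleftrightarrow>
      (\<forall>u<n. \<forall>v<n. b ! u = b ! v \<longleftrightarrow> (\<exists>i<length I. Suc u \<in> I ! i \<and> Suc v \<in> I ! i)) \<and>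
      (\<forall>u<n. \<forall>v<p. b ! u = b' ! v \<longleftrightarrow> (\<exists>(i, j)\<in>M. Suc u \<in> I ! i \<and> Suc v \<in> J ! j)) \<and>
      (\<forall>u<p. \<forall>v<p. b' ! u = b' ! v \<longleftrightarrow> (\<exists>j<length J. Suc u \<in> J ! j \<and> Suc v \<in> J ! j))"
    unfolding E_def .
  show ?thesis
    unfolding monomial_words_iff fdegr_merge degr_merge thetas words
      partial_set_supercomposition_same_block[OF pscI] partial_set_supercomposition_same_block[OF pscJ] bidegI bidegJ
    by (simp only: len length_append set_append Un_iff de_Morgan_disj simp_thms conj_ac)
qed

section \<open>Nontrivial merges are partial set supercompositions\<close>

lemma left_disjoint:
  assumes ij: "i < length I" "i' < length I" and u: "Suc u \<in> left M i" "Suc u \<in> left M i'"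
  shows "i = i'"
proof (cases "u < n")
  case True
  then show ?thesis using u Suc_in_left(1) ij blocksI(6) by blast
next
  case False
  then obtain v where v: "u = n + v" by (metis le_iff_add not_less)
  obtain j j' where "(i, j) \<in> M" "Suc v \<in> J ! j" "(i', j') \<in> M" "Suc v \<in> J ! j'"
    using u unfolding v Suc_in_left(2)[OF ij(1)] Suc_in_left(2)[OF ij(2)] by blast
  then show ?thesis using blocksJ(6)[of j j' v] pairing(2)[of i j] pairing(2)[of i' j'] pairing(4)[of i j i'] by blast
qed

lemma right_disjoint:
  assumes ij: "j < length J" "j' < length J" and u: "Suc u \<in> right M j" "Suc u \<in> right M j'"
  shows "j = j'"
proof (cases "u < n")
  case True
  obtain i i' where "(i, j) \<in> M" "Suc u \<in> I ! i" "(i', j') \<in> M" "Suc u \<in> I ! i'"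
    using u unfolding Suc_in_right(1)[OF True] by blast
  then show ?thesis using blocksI(6)[of i i' u] pairing(1)[of i j] pairing(1)[of i' j'] pairing(3)[of i j j'] by blast
next
  case False
  then obtain v where v: "u = n + v" by (metis le_iff_add not_less)
  show ?thesis using u ij blocksJ(6)[of j j' v] unfolding v Suc_in_right(2) by blast
qed

lemma left_right_disjoint:
  assumes ij: "i < length I" "j < length J" and u: "Suc u \<in> left M i" "Suc u \<in> right M j"
  shows "(i, j) \<in> M"
proof (cases "u < n")
  case True
  obtain i' where "(i', j) \<in> M" "Suc u \<in> I ! i'" using u unfolding Suc_in_right(1)[OF True] by blast
  moreover have "Suc u \<in> I ! i" using u Suc_in_left(1)[OF ij(1) True] by simp
  ultimately show ?thesis using blocksI(6)[of i i' u] ij pairing(1)[of i' j] by blast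
next
  case False
  then obtain v where v: "u = n + v" by (metis le_iff_add not_less)
  obtain j' where "(i, j') \<in> M" "Suc v \<in> J ! j'" using u unfolding v Suc_in_left(2)[OF ij(1)] by blast
  moreover have "Suc v \<in> J ! j" using u unfolding v Suc_in_right(2) by simp
  ultimately show ?thesis using blocksJ(6)[of j j' v] ij pairing(2)[of i j'] by blast
qed

text \<open>The conclusion concerns sets and not positions, because a united block appears in
  \<open>set_merge\<close> both as a \<open>left\<close> and as a \<open>right\<close> block;
  \<open>distinct_merge\<close> separates the positions afterwards.\<close>

lemma merge_blocks_disjoint:
  assumes "A \<in> set (merge I J M)" "B \<in> set (merge I J M)" "Suc u \<in> A" "Suc u \<in> B"
  shows "A = B"
proof -
  consider i i' where "i < length I" "i' < length I" "A = left M i" "B = left M i'"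
    | i j where "i < length I" "j < length J" "A = left M i" "B = right M j"
    | i j where "i < length I" "j < length J" "B = left M i" "A = right M j"
    | j j' where "j < length J" "j' < length J" "A = right M j" "B = right M j'"
    using assms(1,2) unfolding set_merge by blast
  then show ?thesis
  proof cases
    case (1 i i')
    then show ?thesis using left_disjoint[of i i' u] assms(3,4) by simp
  next
    case (2 i j)
    then show ?thesis using left_right_disjoint[of i j u] left_eq_right[of i j] assms(3,4) by simp
  next
    case (3 i j)
    then show ?thesis using left_right_disjoint[of i j u] left_eq_right[of i j] assms(3,4) by simp
  next
    case (4 j j')
    then show ?thesis using right_disjoint[of j j' u] assms(3,4) by simp
  qed
qed

lemma left_nonempty: "i < length I \<Longrightarrow> left M i \<noteq> {}"
  using blocksI(2)[of i] by (simp add: left_def)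

lemma right_nonempty: "j < length J \<Longrightarrow> right M j \<noteq> {}"
  using blocksJ(2)[of j] unfolding right_def shift_def by blast

text \<open>A positive element tells two merged blocks apart. Without one, the merged block is
  \<open>{0}\<close>, so the block of I inside it is already \<open>{0}\<close>, and I lists that
  block only once.\<close>

lemma inj_on_left: "inj_on (left M) {..<length I}"
proof (rule inj_onI)
  fix i i' assume ij: "i \<in> {..<length I}" "i' \<in> {..<length I}" and eq: "left M i = left M i'"
  show "i = i'"
  proof (cases "\<exists>u. Suc u \<in> left M i")
    case True
    then show ?thesis using left_disjoint ij eq by auto
  next
    case False
    then have "left M i = {0}" using eq_zero_block[OF left_nonempty[of i]] ij by simp
    then have "I ! i = {0}" "I ! i' = {0}"
      using eq subset_singletonD[of "I ! i" 0] subset_singletonD[of "I ! i'" 0] blocksI(2)[of i] blocksI(2)[of i'] ij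
      unfolding left_def by auto
    then show ?thesis using ij nth_eq_iff_index_eq[OF set_superpartition_distinct[OF I], of i i'] by simp
  qed
qed

lemma inj_on_right: "inj_on (right M) {..<length J}"
proof (rule inj_onI)
  fix j j' assume ij: "j \<in> {..<length J}" "j' \<in> {..<length J}" and eq: "right M j = right M j'"
  show "j = j'"
  proof (cases "\<exists>u. Suc u \<in> right M j")
    case True
    then show ?thesis using right_disjoint ij eq by auto
  next
    case False
    then have "right M j = {0}" using eq_zero_block[OF right_nonempty[of j]] ij by simp
    then have 0: "Suc (n + v) \<notin> right M j" for v by simp
    have "Suc v \<notin> J ! j" "Suc v \<notin> J ! j'" for v
      using 0[of v] eq unfolding Suc_in_right(2)[symmetric] by simp_all
    then have "J ! j = {0}" "J ! j' = {0}"
      using eq_zero_block[of "J ! j"] eq_zero_block[of "J ! j'"] blocksJ(2)[of j] blocksJ(2)[of j'] ij by simp_all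
    then show ?thesis using ij nth_eq_iff_index_eq[OF set_superpartition_distinct[OF J], of j j'] by simp
  qed
qed

lemma nth_merge_unfermionic:
  assumes "m + q \<le> k" "k < length (merge I J M)"
  shows "merge I J M ! k = sort_key Min (unfermionic M) ! (k - (m + q))"
    and "k - (m + q) < length (unfermionic M)"
proof -
  obtain l where "k = m + (q + l)" using assms(1) by (metis le_iff_add add.assoc)
  then show "merge I J M ! k = sort_key Min (unfermionic M) ! (k - (m + q))"
    "k - (m + q) < length (unfermionic M)"
    using assms(2) by (simp_all add: merge_eq[OF M] nth_append)
qed

lemma zero_in_nth_merge:
  assumes k: "k < length (merge I J M)"
  shows "0 \<in> merge I J M ! k \<longleftrightarrow> k < m + q"
proof (cases "k < m + q")
  case True
  then consider "k < m" | j where "k = m + j" "j < q"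
    by (metis add_less_cancel_left le_iff_add not_less)
  then show ?thesis
    using True blocksI(1) blocksJ(1) by cases (simp_all add: nth_merge zero_in_left zero_in_right)
next
  case False
  then have "merge I J M ! k \<in> set (sort_key Min (unfermionic M))"
    using nth_merge_unfermionic[of k] k by (metis length_sort not_less nth_mem)
  then have "merge I J M ! k \<in> set (unfermionic M)" by simp
  then show ?thesis using False zero_notin_unfermionic by blast
qed

lemma length_merge: "m + q \<le> length (merge I J M)"
  by (simp add: merge_eq[OF M])

text \<open>The only possible repetition is a block \<open>{0}\<close> of I next to a block
  \<open>{0}\<close> of J, as any other coincidence of a \<open>left\<close> and a
  \<open>right\<close> block comes from a chosen pair, which is listed once.\<close>

lemma distinct_merge:
  assumes nt: "nontrivial (merge I J M)"
  shows "distinct (merge I J M)"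
proof -
  have 1: "distinct (map (left M) [0..<m])" "distinct (map (right M) [0..<q])"
    using blocksI(1) blocksJ(1)
    by (auto simp: distinct_map intro: inj_on_subset[OF inj_on_left] inj_on_subset[OF inj_on_right])
  have lr: "(i, j) \<in> M \<or> left M i = {0}" if "i < length I" "j < length J" "left M i = right M j" for i j
    using that left_right_disjoint[OF that(1,2)] eq_zero_block[OF left_nonempty[OF that(1)]] by metis
  have 2: "left M i \<noteq> right M j" if ij: "i < m" "j < q" for i j
  proof
    assume eq: "left M i = right M j"
    have "(i, j) \<notin> M" using pairing(5) ij by fastforce
    then have "left M i = {0}" using lr[OF _ _ eq] ij blocksI(1) blocksJ(1) by simp
    then have "merge I J M ! i = {0}" "merge I J M ! (m + j) = {0}" using nth_merge ij eq by simp_all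
    then have "i = m + j" using nt ij length_merge unfolding nontrivial_iff by simp
    then show False using ij by simp
  qed
  have "distinct (unfermionic M)"
  proof -
    have "left M i \<noteq> right M j" if "i < length I" "0 \<notin> left M i" "j < length J" "j \<notin> snd ` M" for i j
      using lr[OF that(1,3)] that(2,4) by force
    then show ?thesis
      unfolding unfermionic_def
      by (auto simp: distinct_map intro: inj_on_subset[OF inj_on_left] inj_on_subset[OF inj_on_right])
  qed
  moreover have "0 \<in> A" if "A \<in> set (map (left M) [0..<m]) \<union> set (map (right M) [0..<q])" for A
    using that blocksI(1) blocksJ(1) by (auto simp: zero_in_left zero_in_right)
  ultimately show ?thesis
    unfolding merge_eq[OF M] using 1 2 zero_notin_unfermionic by (auto simp: disjoint_iff)
qed

text \<open>Ensures that a merge can be missing from the shuffle only by being trivial.\<close>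

lemma partial_set_supercomposition_merge:
  assumes nt: "nontrivial (merge I J M)"
  shows "partial_set_supercomposition (n + p) (m + q) (merge I J M)"
proof -
  let ?K = "merge I J M"
  have ne: "A \<noteq> {}" if "A \<in> set ?K" for A
    using that unfolding set_merge by (elim UnE imageE) (simp_all add: left_nonempty right_nonempty)
  have sub: "A \<subseteq> {0..n + p}" if "A \<in> set ?K" for A
  proof -
    have "A - {0} \<subseteq> {1..n + p}" using positive_part_merge that by blast
    then show ?thesis by auto
  qed
  have index: "i = j" if "i < length ?K" "j < length ?K" "Suc u \<in> ?K ! i" "Suc u \<in> ?K ! j" for i j u
    using merge_blocks_disjoint[of "?K ! i" "?K ! j" u] that distinct_merge[OF nt] by (simp add: nth_eq_iff_index_eq)
  have disj: "?K ! i \<inter> ?K ! j \<subseteq> {0}" if "i < length ?K" "j < length ?K" "i \<noteq> j" for i j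
  proof
    fix x assume "x \<in> ?K ! i \<inter> ?K ! j"
    then show "x \<in> {0}" using index[OF that(1,2), of "x - 1"] that(3) by (cases x) auto
  qed
  \<comment> \<open>Each fermionic block other than \<open>{0}\<close> owns a positive element,
    chosen by \<open>g\<close>, and by disjointness these are at most n + p in number. The single
    admissible block \<open>{0}\<close> accounts for the summand 1.\<close>
  have bound: "m + q \<le> n + p + 1"
  proof -
    let ?Z = "{i. i < m + q \<and> ?K ! i = {0}}"
    have "card ?Z \<le> Suc 0"
      using nt length_merge unfolding nontrivial_iff by (subst card_le_Suc0_iff_eq) auto
    define g where "g i = (SOME u. Suc u \<in> ?K ! i)" for i
    have g: "Suc (g i) \<in> ?K ! i" if "i \<in> {..<m + q} - ?Z" for i
    proof -
      have "?K ! i \<noteq> {}" "?K ! i \<noteq> {0}" using that ne length_merge by simp_all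
      then have "\<exists>u. Suc u \<in> ?K ! i" using eq_zero_block by blast
      then show ?thesis unfolding g_def by (rule someI_ex)
    qed
    have "inj_on g ({..<m + q} - ?Z)"
    proof (rule inj_onI)
      fix i j assume "i \<in> {..<m + q} - ?Z" "j \<in> {..<m + q} - ?Z" "g i = g j"
      then show "i = j" using index[of i j "g i"] g[of i] g[of j] length_merge by simp
    qed
    moreover have "g ` ({..<m + q} - ?Z) \<subseteq> {..<n + p}"
    proof
      fix x assume "x \<in> g ` ({..<m + q} - ?Z)"
      then obtain i where i: "i \<in> {..<m + q} - ?Z" "x = g i" by blast
      have "?K ! i \<subseteq> {0..n + p}" using sub i length_merge by simp
      then show "x \<in> {..<n + p}" using g[OF i(1)] i(2) by auto
    qed
    ultimately have "card ({..<m + q} - ?Z) \<le> n + p"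
      using card_inj_on_le[of g _ "{..<n + p}"] by simp
    moreover have "card ({..<m + q} - ?Z) = (m + q) - card ?Z"
      by (subst card_Diff_subset) auto
    ultimately show ?thesis using \<open>card ?Z \<le> Suc 0\<close> by simp
  qed
  \<comment> \<open>Sorting yields only the weak inequality. A common minimum of two nonfermionic
    blocks would be a common positive element, which disjointness forbids.\<close>
  have mins: "Min (?K ! i) < Min (?K ! j)" if ij: "m + q \<le> i" "i < j" "j < length ?K" for i j
  proof -
    have "sorted (map Min (sort_key Min (unfermionic M)))" by simp
    then have le: "Min (?K ! i) \<le> Min (?K ! j)"
      unfolding sorted_iff_nth_mono using ij nth_merge_unfermionic[of i] nth_merge_unfermionic[of j] by simp
    have fin: "finite (?K ! k) \<and> ?K ! k \<noteq> {}" if "k < length ?K" for k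
      using ne sub that by (meson finite_atLeastAtMost nth_mem rev_finite_subset)
    have "Min (?K ! i) \<in> ?K ! i" "Min (?K ! j) \<in> ?K ! j" using fin ij by simp_all
    moreover have "0 \<notin> ?K ! i" using zero_in_nth_merge[of i] ij by simp
    ultimately have "Min (?K ! i) \<noteq> Min (?K ! j)" using disj[of i j] ij by auto
    then show ?thesis using le by simp
  qed
  show ?thesis
    unfolding partial_set_supercomposition_def
    by (intro conjI ballI allI impI bound length_merge ne sub positive_part_merge disj zero_in_nth_merge mins; assumption)
qed

text \<open>Two blocks \<open>{0}\<close> contain 0, so both sit among the first m + q positions,
  and exchanging their theta applies.\<close>

lemma monomial_function_trivial_merge:
  assumes "\<not> nontrivial (merge I J M)"
  shows "monomial_function (merge I J M) = 0"
proof -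
  obtain i j where ij: "i < length (merge I J M)" "j < length (merge I J M)" "i < j"
    and "merge I J M ! i = {0}" "merge I J M ! j = {0}"
    using assms unfolding nontrivial_iff by (metis linorder_neqE_nat)
  then show ?thesis
    using zero_in_nth_merge[of j] by (intro monomial_function_eq_0[of i j]) (simp_all add: fdegr_merge)
qed

end

section \<open>The pairing read off from two words\<close>

definition matching :: "nat list \<Rightarrow> nat list \<Rightarrow> nat list \<Rightarrow> nat list \<Rightarrow> (nat \<times> nat) set" where
  "matching a b a' b' =
     {(i, j). i < length I \<and> j < length J \<and> block_value I a b i = block_value J a' b' j}"

context
  fixes a b a' b' :: "nat list"
  assumes ab: "(a, b) \<in> monomial_words I" and ab': "(a', b') \<in> monomial_words J"
    and distinct: "distinct (a @ a')"
begin

lemma lengths: "length a = m" "length b = n" "length a' = q" "length b' = p"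
  using ab ab' by (simp_all add: monomial_words_iff)

text \<open>The values of fermionic blocks are theta indices, and a repeated theta makes the product
  of the two words vanish. Hence \<open>matching\<close> never joins two fermionic blocks.\<close>

lemma fermionic_values_distinct:
  assumes "i < m" "j < q"
  shows "block_value I a b i \<noteq> block_value J a' b' j"
proof -
  have "block_value I a b i = a ! i" "block_value J a' b' j = a' ! j"
    using assms blocksI(1,7) blocksJ(1,7) by (simp_all add: block_value_def)
  moreover have "a ! i \<in> set a" "a' ! j \<in> set a'" using assms lengths by simp_all
  ultimately show ?thesis using distinct by auto
qed

text \<open>Values are injective on the blocks of each factor, so no block can acquire two
  partners.\<close>

lemma block_pairing_matching: "block_pairing I J (matching a b a' b')"
proof -
  have "inj_on fst (matching a b a' b')"
    using inj_on_block_value[OF J ab'] by (auto simp: inj_on_def matching_def)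
  moreover have "inj_on snd (matching a b a' b')"
    using inj_on_block_value[OF I ab] by (auto simp: inj_on_def matching_def)
  moreover have "\<not> (0 \<in> I ! i \<and> 0 \<in> J ! j)" if "(i, j) \<in> matching a b a' b'" for i j
    using that fermionic_values_distinct[of i j] blocksI(7)[of i] blocksJ(7)[of j] by (auto simp: matching_def)
  ultimately show ?thesis by (auto simp: block_pairing_def matching_def)
qed

text \<open>The mixed conditions of \<open>merge_word_iff\<close> compare letters, whereas
  \<open>matching\<close> compares block values. The two agree because each letter carries the value
  of its block and each block is represented by some letter.\<close>

lemma merge_word_iff_matching:
  assumes M: "block_pairing I J M"
  shows "(a @ a', b @ b') \<in> monomial_words (merge I J M) \<longleftrightarrow> M = matching a b a' b'"
proof -
  let ?f = "block_value I a b" and ?g = "block_value J a' b'"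
  note less = pairing_less[OF M]
  have fa: "a ! i = ?f i" "i < length I" if "i < m" for i
    using that blocksI(1,7) by (simp_all add: block_value_def)
  have ga: "a' ! j = ?g j" "j < length J" if "j < q" for j
    using that blocksJ(1,7) by (simp_all add: block_value_def)
  note fb = eq_block_value_iff[OF pscI ab] and gb = eq_block_value_iff[OF pscJ ab']
  show ?thesis
    unfolding merge_word_iff[OF M lengths]
  proof
    assume *: "(a, b) \<in> monomial_words I \<and> (a', b') \<in> monomial_words J \<and>
      (\<forall>i<m. \<forall>v<p. a ! i = b' ! v \<longleftrightarrow> (\<exists>j. (i, j) \<in> M \<and> Suc v \<in> J ! j)) \<and>
      (\<forall>j<q. \<forall>u<n. a' ! j = b ! u \<longleftrightarrow> (\<exists>i. (i, j) \<in> M \<and> Suc u \<in> I ! i)) \<and>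
      (\<forall>u<n. \<forall>v<p. b ! u = b' ! v \<longleftrightarrow> (\<exists>(i, j)\<in>M. Suc u \<in> I ! i \<and> Suc v \<in> J ! j))"
    have "(i, j) \<in> M \<longleftrightarrow> ?f i = ?g j" if ij: "i < length I" "j < length J" for i j
    proof -
      have I_eq: "i' = i" if "(i', j') \<in> M" "Suc u \<in> I ! i'" "Suc u \<in> I ! i" for i' j' u
        using that less[of i' j'] blocksI(6)[of i' i u] ij by blast
      have J_eq: "j' = j" if "(i', j') \<in> M" "Suc v \<in> J ! j'" "Suc v \<in> J ! j" for i' j' v
        using that less[of i' j'] blocksJ(6)[of j' j v] ij by blast
      consider "i < m" "j < q" | "i < m" "q \<le> j" | "m \<le> i" "j < q" | "m \<le> i" "q \<le> j" by linarith
      then show ?thesis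
      proof cases
        case 1
        \<comment> \<open>No condition on words compares two theta, but here both sides are false: a
          pairing avoids two fermionic blocks, and their theta differ.\<close>
        then show ?thesis using fermionic_values_distinct pairing(5)[OF M, of i j] by auto
      next
        case 2
        obtain v where v: "v < p" "Suc v \<in> J ! j"
          using nonfermionic_block_nonempty[OF pscJ ij(2) 2(2)] .
        have "?f i = ?g j \<longleftrightarrow> a ! i = b' ! v" using fa 2 gb[OF ij(2) v(1)] v(2) by auto
        also have "\<dots> \<longleftrightarrow> (\<exists>j'. (i, j') \<in> M \<and> Suc v \<in> J ! j')" using * 2 v by blast
        also have "\<dots> \<longleftrightarrow> (i, j) \<in> M" using J_eq v by blast
        finally show ?thesis by simp
      next
        case 3
        obtain u where u: "u < n" "Suc u \<in> I ! i"
          using nonfermionic_block_nonempty[OF pscI ij(1) 3(1)] .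
        have "?f i = ?g j \<longleftrightarrow> a' ! j = b ! u" using ga 3 fb[OF ij(1) u(1)] u(2) by auto
        also have "\<dots> \<longleftrightarrow> (\<exists>i'. (i', j) \<in> M \<and> Suc u \<in> I ! i')" using * 3 u by blast
        also have "\<dots> \<longleftrightarrow> (i, j) \<in> M" using I_eq u by blast
        finally show ?thesis by simp
      next
        case 4
        obtain u where u: "u < n" "Suc u \<in> I ! i"
          using nonfermionic_block_nonempty[OF pscI ij(1) 4(1)] .
        obtain v where v: "v < p" "Suc v \<in> J ! j"
          using nonfermionic_block_nonempty[OF pscJ ij(2) 4(2)] .
        have "?f i = ?g j \<longleftrightarrow> b ! u = b' ! v" using fb[OF ij(1) u(1)] u(2) gb[OF ij(2) v(1)] v(2) by auto
        also have "\<dots> \<longleftrightarrow> (\<exists>(i', j')\<in>M. Suc u \<in> I ! i' \<and> Suc v \<in> J ! j')" using * u v by blast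
        also have "\<dots> \<longleftrightarrow> (i, j) \<in> M" using I_eq J_eq u v by blast
        finally show ?thesis by simp
      qed
    qed
    then show "M = matching a b a' b'"
      using less by (auto simp: matching_def)
  next
    assume M_eq: "M = matching a b a' b'"
    have M_iff: "(i, j) \<in> M \<longleftrightarrow> i < length I \<and> j < length J \<and> ?f i = ?g j" for i j
      unfolding M_eq matching_def by simp
    have 1: "a ! i = b' ! v \<longleftrightarrow> (\<exists>j. (i, j) \<in> M \<and> Suc v \<in> J ! j)" if iv: "i < m" "v < p" for i v
    proof -
      \<comment> \<open>Every x lies in some block and its index is the value of that block, so an
        equality of letters is an equality of block values.\<close>
      obtain j where "j < length J" "Suc v \<in> J ! j" using blocksJ(5)[OF iv(2)] by blast
      then show ?thesis
        unfolding M_iff using fa[OF iv(1)] gb[OF _ iv(2)] by metis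
    qed
    have 2: "a' ! j = b ! u \<longleftrightarrow> (\<exists>i. (i, j) \<in> M \<and> Suc u \<in> I ! i)" if ju: "j < q" "u < n" for j u
    proof -
      obtain i where "i < length I" "Suc u \<in> I ! i" using blocksI(5)[OF ju(2)] by blast
      then show ?thesis
        unfolding M_iff using ga[OF ju(1)] fb[OF _ ju(2)] by metis
    qed
    have 3: "b ! u = b' ! v \<longleftrightarrow> (\<exists>(i, j)\<in>M. Suc u \<in> I ! i \<and> Suc v \<in> J ! j)" if uv: "u < n" "v < p" for u v
    proof -
      obtain i j where i: "i < length I" "Suc u \<in> I ! i" and j: "j < length J" "Suc v \<in> J ! j"
        using blocksI(5)[OF uv(1)] blocksJ(5)[OF uv(2)] by blast
      have "b ! u = b' ! v \<longleftrightarrow> (i, j) \<in> M"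
        unfolding M_iff using i j fb[OF i(1) uv(1)] gb[OF j(1) uv(2)] by simp
      moreover have "(i', j') = (i, j)" if "(i', j') \<in> M" "Suc u \<in> I ! i'" "Suc v \<in> J ! j'" for i' j'
        using that less[OF that(1)] blocksI(6)[of i' i u] blocksJ(6)[of j' j v] i j by blast
      ultimately show ?thesis using i j by blast
    qed
    show "(a, b) \<in> monomial_words I \<and> (a', b') \<in> monomial_words J \<and>
      (\<forall>i<m. \<forall>v<p. a ! i = b' ! v \<longleftrightarrow> (\<exists>j. (i, j) \<in> M \<and> Suc v \<in> J ! j)) \<and>
      (\<forall>j<q. \<forall>u<n. a' ! j = b ! u \<longleftrightarrow> (\<exists>i. (i, j) \<in> M \<and> Suc u \<in> I ! i)) \<and>
      (\<forall>u<n. \<forall>v<p. b ! u = b' ! v \<longleftrightarrow> (\<exists>(i, j)\<in>M. Suc u \<in> I ! i \<and> Suc v \<in> J ! j))"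
      using ab ab' 1 2 3 by blast
  qed
qed

end

section \<open>The product formula\<close>

text \<open>The right side determines M from the word alone. This gives both that the merges cover
  all the words of the product and that different merges share none.\<close>

lemma merge_words_split:
  assumes M: "block_pairing I J M" and d: "distinct c"
  shows "(c, w) \<in> monomial_words (merge I J M) \<longleftrightarrow>
    (take m c, take n w) \<in> monomial_words I \<and> (drop m c, drop n w) \<in> monomial_words J \<and>
    M = matching (take m c) (take n w) (drop m c) (drop n w)"
proof -
  have d': "distinct (take m c @ drop m c)" using d by simp
  have "(c, w) \<in> monomial_words (merge I J M) \<Longrightarrow>
      (take m c, take n w) \<in> monomial_words I \<and> (drop m c, drop n w) \<in> monomial_words J"
  proof -
    assume c: "(c, w) \<in> monomial_words (merge I J M)"
    then have "length c = m + q" "length w = n + p"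
      by (simp_all add: monomial_words_iff fdegr_merge[OF M] degr_merge[OF M])
    then show ?thesis
      using c merge_word_iff[OF M, of "take m c" "take n w" "drop m c" "drop n w"] by simp
  qed
  then show ?thesis
    using merge_word_iff_matching[of "take m c" "take n w" "drop m c" "drop n w", OF _ _ d' M] by auto
qed

theorem monomial_function_times:
  "monomial_function I * monomial_function J = (\<Sum>K\<in>superpartition_shuffle I J. monomial_function K)"
proof (rule superseries_eqI)
  fix U :: "nat set" and w
  assume U: "finite U"
  let ?P = "Collect (block_pairing I J)"
  \<comment> \<open>The sum is taken over merged lists and not over pairings, in accordance with the
    shuffle, which is a set of lists.\<close>
  let ?S = "merge I J ` ?P"
  have "?P \<subseteq> Pow ({..<length I} \<times> {..<length J})" by (auto simp: block_pairing_def)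
  then have finS: "finite ?S" by (meson finite_Pow_iff finite_SigmaI finite_imageI finite_lessThan finite_subset)
  have split: "{c. distinct c \<and> set c = U \<and> (take m c, take n w) \<in> monomial_words I \<and>
      (drop m c, drop n w) \<in> monomial_words J} = (\<Union>K\<in>?S. monomial_thetas K U w)"
  proof (intro set_eqI iffI)
    fix c assume "c \<in> {c. distinct c \<and> set c = U \<and> (take m c, take n w) \<in> monomial_words I \<and>
      (drop m c, drop n w) \<in> monomial_words J}"
    then have c: "distinct c" "set c = U" "(take m c, take n w) \<in> monomial_words I"
      "(drop m c, drop n w) \<in> monomial_words J" by auto
    let ?M = "matching (take m c) (take n w) (drop m c) (drop n w)"
    have M: "block_pairing I J ?M" using block_pairing_matching[OF c(3,4)] c(1) by simp
    then have "c \<in> monomial_thetas (merge I J ?M) U w"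
      using c merge_words_split[OF M c(1)] by (simp add: monomial_thetas_def)
    then show "c \<in> (\<Union>K\<in>?S. monomial_thetas K U w)" using M by blast
  next
    fix c assume "c \<in> (\<Union>K\<in>?S. monomial_thetas K U w)"
    then obtain M where "block_pairing I J M" "c \<in> monomial_thetas (merge I J M) U w" by blast
    then show "c \<in> {c. distinct c \<and> set c = U \<and> (take m c, take n w) \<in> monomial_words I \<and>
      (drop m c, drop n w) \<in> monomial_words J}"
      using merge_words_split[of M c w] by (simp add: monomial_thetas_def)
  qed
  have "coeff (monomial_function I * monomial_function J) U w =
      sum theta_sign (\<Union>K\<in>?S. monomial_thetas K U w)"
    unfolding coeff_monomial_function_times[OF U] bidegI bidegJ split ..
  also have "\<dots> = (\<Sum>K\<in>?S. sum theta_sign (monomial_thetas K U w))"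
  proof (rule sum.UNION_disjoint[OF finS])
    show "\<forall>K\<in>?S. finite (monomial_thetas K U w)" using finite_monomial_thetas[OF U] by blast
    show "\<forall>K\<in>?S. \<forall>L\<in>?S. K \<noteq> L \<longrightarrow> monomial_thetas K U w \<inter> monomial_thetas L U w = {}"
    proof (intro ballI impI)
      fix K L assume "K \<in> ?S" "L \<in> ?S" and ne: "K \<noteq> L"
      then obtain M M' where M: "block_pairing I J M" "K = merge I J M"
        and M': "block_pairing I J M'" "L = merge I J M'" by blast
      \<comment> \<open>A common word would force both pairings to be the \<open>matching\<close> of
        its two halves, and then K = L.\<close>
      have "c \<notin> monomial_thetas L U w" if "c \<in> monomial_thetas K U w" for c
        using that ne merge_words_split[OF M(1), of c w] merge_words_split[OF M'(1), of c w]
        unfolding M(2) M'(2) monomial_thetas_def by auto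
      then show "monomial_thetas K U w \<inter> monomial_thetas L U w = {}" by blast
    qed
  qed
  also have "\<dots> = (\<Sum>K\<in>superpartition_shuffle I J. coeff (monomial_function K) U w)"
    unfolding coeff_monomial_function_thetas[symmetric]
  proof (rule sum.mono_neutral_right[OF finS])
    show "superpartition_shuffle I J \<subseteq> ?S" by (auto simp: superpartition_shuffle_def)
    show "\<forall>K\<in>?S - superpartition_shuffle I J. coeff (monomial_function K) U w = 0"
    proof
      fix K assume K: "K \<in> ?S - superpartition_shuffle I J"
      then obtain M where M: "block_pairing I J M" "K = merge I J M" by blast
      then have "\<not> nontrivial K"
        using K partial_set_supercomposition_merge[OF M(1)] unfolding superpartition_shuffle_def by blast
      then show "coeff (monomial_function K) U w = 0"
        using monomial_function_trivial_merge[OF M(1)] M(2) by (simp add: zero_superseries.rep_eq)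
    qed
  qed
  also have "\<dots> = coeff (\<Sum>K\<in>superpartition_shuffle I J. monomial_function K) U w"
    by (simp only: coeff_sum)
  finally show "coeff (monomial_function I * monomial_function J) U w =
      coeff (\<Sum>K\<in>superpartition_shuffle I J. monomial_function K) U w" .
qed

end

theorem proposition3p5:
  fixes I J :: "nat set list" and n m p q :: nat
  assumes "set_superpartition n m I" and "set_superpartition p q J"
  shows "monomial_function I * monomial_function J =
    (\<Sum>K\<in>superpartition_shuffle I J. monomial_function K)"
proof -
  interpret superpartition_pair I J n m p q
    using assms by unfold_locales
  show ?thesis by (rule monomial_function_times)
qed

end
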